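(* Let $(X_n,\ell_n,o_n,\mathcal U_n)$, $n\in\mathbb N$, and $(X,\ell,o,\mathcal U)$ be covered Lorentzian pre-length spaces such that $(X_n,\ell_n,o_n,\mathcal U_n)$ converges to $(X,\ell,o,\mathcal U)$ in the pointed Lorentzian Gromov--Hausdorff (pLGH) sense, where $\tau=\max(0,\ell)$ is uniformly continuous with respect to a limit uniform structure on $X$. If all $(X_n,\ell_n)$ are globally hyperbolic, then the timelike interior $I^+_{\overline\ll}(\overline X)\cap I^-_{\overline\ll}(\overline X)$ of the completion $(\overline X,\overline\ell)$ of $X$ is globally hyperbolic.
   Context: Lorentzian pre-length space: a set $X$ with $\ell:X\times X\to\{-\infty\}\cup[0,\infty]$ satisfying $\ell(x,y)+\ell(y,z)\le\ell(x,z)$ for all $x,y,z$ (convention $-\infty+\infty=\infty+(-\infty)=-\infty$ on the left) and $\ell(x,x)\ge 0$ for all $x$, where $X$ carries a topology finer than (at least as fine as) the one generated by the sub-base of all $I^\pm(x)$. $\tau:=\max(0,\ell)$. $x\ll y$ iff $\ell(x,y)>0$, $x\le y$ iff $\ell(x,y)\ge0$; $I^+(x)=\{y:x\ll y\}$, $I^-(x)=\{y:y\ll x\}$, $J^+(x)=\{y:x\le y\}$, $J^-(x)=\{y:y\le x\}$, $J(x,y)=J^+(x)\cap J^-(y)$; $I^\pm(A)=\bigcup_{a\in A}I^\pm(a)$. Globally hyperbolic: $\le$ is a closed partial order and all causal diamonds $J(x,y)$ are compact. $\varepsilon$-net for $A\subseteq X$: a collection $S=(J(p_i,q_i))_{i\in\Omega}$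 of causal diamonds with $\tau(p_i,q_i)\le\varepsilon$ and $A\subseteq\bigcup_iJ(p_i,q_i)$ (w.l.o.g. each diamond meets $A$); $V(S)=\{p_i,q_i\}$. A correspondence between sets is a relation projecting onto both factors; its distortion is $\operatorname{dis}(R)=\sup_{(x,y),(x',y')\in R}|\ell(x,x')-\rho(y,y')|$ with $|-\infty-(-\infty)|=0$, $|-\infty-z|=+\infty$ for $z\in\mathbb R$; similarly $\operatorname{dis}(f)$ for a map $f$. LGH-convergence of subsets $A_n\subseteq X_n$ to $A\subseteq X$: for all $\varepsilon>0$ there exist $n_0$ and finite $\varepsilon$-nets $S$ for $A$ in $X$, $S_n$ for $A_n$ in $X_n$ ($n\ge n_0$) such that (1) $|S_n|=|S|$; (2) for $n\ge n_0$ there is a correspondence $R_n$ of $V(S_n)$ and $V(S)$ with $\operatorname{dis}(R_n)\to0$; (3) (extension property) for every $l\ge1$, if $S^l,S^l_n$ are finite $\frac1l$-nets for $A,A_n$ satisfying (1) and (2) with $\varepsilon=\frac1l$ (i.e. $|S^l_n|=|S^l|$ for all large $n$, with correspondences of $V(S^l_n)$ and $V(S^l)$ whose distortions tend to $0$ as $n\to\infty$) and $f^l_n:V(S^l)\to V(S^l_n)$ realizes a correspondence, there is an extension $f^{l+1}_{n'}:V(S^l)\cup V(S^{l+1})\to V(S^l_{n'})\cup V(S^{l+1}_{n'})$ of $f^l_{n'}$ with $\operatorname{dis}(f^{l+1}_{n'})\le\operatorname{dis}(f^l_{n'})$ for some $n'\ge n$; (4) (forward density) with $\mathcal V=\bigcup_{l\ge1}V(S^l)$,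 each $x\in A\setminus\mathcal V$ is a limit of $x_k\in\mathcal V$ with $x_k\le x_{k+1}\le x$. Covered Lorentzian pre-length space $(X,\ell,o,\mathcal U)$: $o\in X$ and a countable cover $\mathcal U=(U_k)_k$ of $X$ with $U_k\subseteq U_{k+1}$, $o\in U_k$, $\sup_{x,y\in U_k}\tau(x,y)<\infty$. pLGH-convergence means $U_{k,n}\to U_k$ in the LGH sense for each $k$. Limit uniform structure: let $S\subseteq X$ be the countable set which is the union over $k,l$ of the vertices of the $\frac1l$-nets of $U_k$ realizing the convergence. $\mathfrak U_S$ is the uniform structure on $X$ generated by the entourages $V^s_\delta=\{(y,z):|\ell(y,s)-\ell(z,s)|<\delta,\ |\ell(s,y)-\ell(s,z)|<\delta\}$, $s\in S$, $\delta>0$ (same conventions for $-\infty$). It and its topology are called a limit uniform structure and limit topology. Completion: let $\overline X$ be the completion of the uniform space $(X,\mathfrak U_S)$ and $\overline\tau$ the continuous extension of the uniformly continuous $\tau$. Put $\bar x\,\overline\ll\,\bar y$ iff $\overline\tau(\bar x,\bar y)>0$; $\bar x\,\overline\le\,\bar y$ iff for all $\bar z\in\overline X$: $\overline\tau(\bar z,\bar y)\ge\overline\tau(\bar z,\bar x)$ and $\overline\tau(\bar x,\bar z)\ge\overline\tau(\bar y,\bar z)$; $\overline\ell=\overline\tau$ if $\bar x\,\overline\le\,\bar y$ and $-\infty$ otherwise. Finally points $\bar x,\bar y$ with $\overline\tau(\bar x,\cdot)=\overline\tau(\bar y,\cdot)$ and $\overline\tau(\cdot,\bar x)=\overline\tau(\cdot,\bar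 y)$ are identified. The result $(\overline X,\overline\ell)$ is the completion. *)

theory Defs
  imports "HOL-Analysis.Analysis"
begin

section \<open>Lorentzian pre-length spaces\<close>

text \<open>
  A space is given by a topology, whose \<^const>\<open>topspace\<close> is the underlying set \<open>X\<close>, and a function
  \<open>ell\<close>, of which only the values on \<open>X \<times> X\<close> matter.
\<close>

text \<open>
  On \<^typ>\<open>ereal\<close>, \<open>\<infinity> + -\<infinity> = \<infinity>\<close>; in the reverse triangle inequality \<open>-\<infinity>\<close> has to be absorbing.
\<close>
definition lsum :: "ereal \<Rightarrow> ereal \<Rightarrow> ereal" where
  "lsum a b = (if a = -\<infinity> \<or> b = -\<infinity> then -\<infinity> else a + b)"

definition tau :: "('a \<Rightarrow> 'a \<Rightarrow> ereal) \<Rightarrow> 'a \<Rightarrow> 'a \<Rightarrow> ereal" where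
  "tau ell x y = max 0 (ell x y)"

definition timelike_future :: "'a topology \<Rightarrow> ('a \<Rightarrow> 'a \<Rightarrow> ereal) \<Rightarrow> 'a \<Rightarrow> 'a set" where
  "timelike_future T ell x = {y \<in> topspace T. ell x y > 0}"

definition timelike_past :: "'a topology \<Rightarrow> ('a \<Rightarrow> 'a \<Rightarrow> ereal) \<Rightarrow> 'a \<Rightarrow> 'a set" where
  "timelike_past T ell x = {y \<in> topspace T. ell y x > 0}"

definition causal_diamond :: "'a topology \<Rightarrow> ('a \<Rightarrow> 'a \<Rightarrow> ereal) \<Rightarrow> 'a \<Rightarrow> 'a \<Rightarrow> 'a set" where
  "causal_diamond T ell x y = {z \<in> topspace T. ell x z \<ge> 0 \<and> ell z y \<ge> 0}"

definition causal_rel :: "'a topology \<Rightarrow> ('a \<Rightarrow> 'a \<Rightarrow> ereal) \<Rightarrow> ('a \<times> 'a) set" where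
  "causal_rel T ell = {(x, y). x \<in> topspace T \<and> y \<in> topspace T \<and> ell x y \<ge> 0}"

text \<open>
  The last conjunct says that the topology is at least as fine as the one with sub-base all
  chronological futures and pasts.
\<close>
definition lorentzian_pre_length_space :: "'a topology \<Rightarrow> ('a \<Rightarrow> 'a \<Rightarrow> ereal) \<Rightarrow> bool" where
  "lorentzian_pre_length_space T ell \<longleftrightarrow>
     (\<forall>x\<in>topspace T. \<forall>y\<in>topspace T. ell x y = -\<infinity> \<or> ell x y \<ge> 0) \<and>
     (\<forall>x\<in>topspace T. \<forall>y\<in>topspace T. \<forall>z\<in>topspace T. lsum (ell x y) (ell y z) \<le> ell x z) \<and>
     (\<forall>x\<in>topspace T. ell x x \<ge> 0) \<and>
     (\<forall>x\<in>topspace T. openin T (timelike_future T ell x) \<and> openin T (timelike_past T ell x))"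

definition globally_hyperbolic :: "'a topology \<Rightarrow> ('a \<Rightarrow> 'a \<Rightarrow> ereal) \<Rightarrow> bool" where
  "globally_hyperbolic T ell \<longleftrightarrow>
     lorentzian_pre_length_space T ell \<and>
     partial_order_on (topspace T) (causal_rel T ell) \<and>
     closedin (prod_topology T T) (causal_rel T ell) \<and>
     (\<forall>x\<in>topspace T. \<forall>y\<in>topspace T. compactin T (causal_diamond T ell x y))"

definition covered_lorentzian_pre_length_space ::
    "'a topology \<Rightarrow> ('a \<Rightarrow> 'a \<Rightarrow> ereal) \<Rightarrow> 'a \<Rightarrow> (nat \<Rightarrow> 'a set) \<Rightarrow> bool" where
  "covered_lorentzian_pre_length_space T ell p U \<longleftrightarrow>
     lorentzian_pre_length_space T ell \<and> p \<in> topspace T \<and>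
     (\<Union>k. U k) = topspace T \<and>
     (\<forall>k. U k \<subseteq> U (Suc k) \<and> p \<in> U k \<and> (SUP (x, y)\<in>U k \<times> U k. tau ell x y) < \<infinity>)"


section \<open>Nets, correspondences and convergence\<close>

text \<open>
  A finite net is a finite indexed family of causal diamonds, hence a list of vertex pairs; its
  cardinality is the length of the list.
\<close>
definition finite_net ::
    "'a topology \<Rightarrow> ('a \<Rightarrow> 'a \<Rightarrow> ereal) \<Rightarrow> real \<Rightarrow> 'a set \<Rightarrow> ('a \<times> 'a) list \<Rightarrow> bool" where
  "finite_net T ell \<epsilon> A S \<longleftrightarrow>
     set S \<subseteq> topspace T \<times> topspace T \<and>
     (\<forall>(p, q)\<in>set S. tau ell p q \<le> ereal \<epsilon> \<and> causal_diamond T ell p q \<inter> A \<noteq> {}) \<and>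
     A \<subseteq> (\<Union>(p, q)\<in>set S. causal_diamond T ell p q)"

definition vertices :: "('a \<times> 'a) list \<Rightarrow> 'a set" where
  "vertices S = fst ` set S \<union> snd ` set S"

text \<open>
  \<open>\<bar>a - b\<bar>\<close> with \<open>\<bar>-\<infinity> - (-\<infinity>)\<bar> = 0\<close>; on \<^typ>\<open>ereal\<close> the difference \<open>-\<infinity> - (-\<infinity>)\<close> would be \<open>\<infinity>\<close>.
\<close>
definition ldiff :: "ereal \<Rightarrow> ereal \<Rightarrow> ereal" where
  "ldiff a b = (if a = b then 0 else \<bar>a - b\<bar>)"

definition correspondence :: "'a set \<Rightarrow> 'b set \<Rightarrow> ('a \<times> 'b) set \<Rightarrow> bool" where
  "correspondence V W R \<longleftrightarrow> R \<subseteq> V \<times> W \<and> fst ` R = V \<and> snd ` R = W"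

text \<open>The inserted \<open>0\<close> only affects the empty relation, whose supremum in \<^typ>\<open>ereal\<close> is \<open>-\<infinity>\<close>.\<close>
definition distortion ::
    "('a \<Rightarrow> 'a \<Rightarrow> ereal) \<Rightarrow> ('b \<Rightarrow> 'b \<Rightarrow> ereal) \<Rightarrow> ('a \<times> 'b) set \<Rightarrow> ereal" where
  "distortion ell \<rho> R =
     Sup (insert 0 {ldiff (ell x x') (\<rho> y y') | x y x' y'. (x, y) \<in> R \<and> (x', y') \<in> R})"

definition graph_on :: "'a set \<Rightarrow> ('a \<Rightarrow> 'b) \<Rightarrow> ('a \<times> 'b) set" where
  "graph_on V f = (\<lambda>x. (x, f x)) ` V"

text \<open>
  Below, \<open>(T, ell)\<close> with \<open>A\<close> is the limit, and \<open>(Ts n, ells n)\<close> with \<open>As n\<close> the sequence. Nets for \<open>As n\<close>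
  only need to exist for large \<open>n\<close>.
\<close>
definition nets_converge ::
    "'b topology \<Rightarrow> ('b \<Rightarrow> 'b \<Rightarrow> ereal) \<Rightarrow> 'b set \<Rightarrow>
     (nat \<Rightarrow> 'a topology) \<Rightarrow> (nat \<Rightarrow> 'a \<Rightarrow> 'a \<Rightarrow> ereal) \<Rightarrow> (nat \<Rightarrow> 'a set) \<Rightarrow>
     real \<Rightarrow> ('b \<times> 'b) list \<Rightarrow> (nat \<Rightarrow> ('a \<times> 'a) list) \<Rightarrow> bool" where
  "nets_converge T ell A Ts ells As \<epsilon> S Sn \<longleftrightarrow>
     finite_net T ell \<epsilon> A S \<and>
     (\<forall>\<^sub>F n in sequentially.
        finite_net (Ts n) (ells n) \<epsilon> (As n) (Sn n) \<and> length (Sn n) = length S) \<and>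
     (\<exists>R. (\<forall>\<^sub>F n in sequentially. correspondence (vertices S) (vertices (Sn n)) (R n)) \<and>
          (\<lambda>n. distortion ell (ells n) (R n)) \<longlonglongrightarrow> 0)"

text \<open>
  \<open>S l\<close> and \<open>Sn l n\<close> are the nets at scale \<open>1/l\<close>. The maps \<open>f n\<close> to be extended are those whose graphs
  are correspondences with distortion tending to \<open>0\<close>.
\<close>
definition extension_property ::
    "('b \<Rightarrow> 'b \<Rightarrow> ereal) \<Rightarrow> (nat \<Rightarrow> 'a \<Rightarrow> 'a \<Rightarrow> ereal) \<Rightarrow>
     (nat \<Rightarrow> ('b \<times> 'b) list) \<Rightarrow> (nat \<Rightarrow> nat \<Rightarrow> ('a \<times> 'a) list) \<Rightarrow> bool" where
  "extension_property ell ells S Sn \<longleftrightarrow>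
     (\<forall>l\<ge>1. \<forall>f.
        (\<forall>\<^sub>F n in sequentially.
           correspondence (vertices (S l)) (vertices (Sn l n)) (graph_on (vertices (S l)) (f n))) \<and>
        (\<lambda>n. distortion ell (ells n) (graph_on (vertices (S l)) (f n))) \<longlonglongrightarrow> 0 \<longrightarrow>
        (\<forall>n. \<exists>n'\<ge>n. \<exists>g.
           g ` (vertices (S l) \<union> vertices (S (Suc l)))
             \<subseteq> vertices (Sn l n') \<union> vertices (Sn (Suc l) n') \<and>
           (\<forall>x\<in>vertices (S l). g x = f n' x) \<and>
           distortion ell (ells n') (graph_on (vertices (S l) \<union> vertices (S (Suc l))) g)
             \<le> distortion ell (ells n') (graph_on (vertices (S l)) (f n'))))"

definition forward_dense ::
    "'b topology \<Rightarrow> ('b \<Rightarrow> 'b \<Rightarrow> ereal) \<Rightarrow> 'b set \<Rightarrow> 'b set \<Rightarrow> bool" where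
  "forward_dense T ell A V \<longleftrightarrow>
     (\<forall>x\<in>A - V. \<exists>\<xi>. range \<xi> \<subseteq> V \<and> limitin T \<xi> x sequentially \<and>
        (\<forall>k. ell (\<xi> k) (\<xi> (Suc k)) \<ge> 0 \<and> ell (\<xi> (Suc k)) x \<ge> 0 \<and> ell (\<xi> k) x \<ge> 0))"

text \<open>
  The nets \<open>S l\<close>, \<open>l \<ge> 1\<close>, realize the convergence of \<open>As n\<close> to \<open>A\<close>. Asking for nets at the scales \<open>1/l\<close>
  is the same as asking for nets at every scale \<open>\<epsilon> > 0\<close>, as a net at a scale below \<open>\<epsilon>\<close> is an \<open>\<epsilon>\<close>-net.
\<close>
definition LGH_realizing_nets ::
    "'b topology \<Rightarrow> ('b \<Rightarrow> 'b \<Rightarrow> ereal) \<Rightarrow> 'b set \<Rightarrow>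
     (nat \<Rightarrow> 'a topology) \<Rightarrow> (nat \<Rightarrow> 'a \<Rightarrow> 'a \<Rightarrow> ereal) \<Rightarrow> (nat \<Rightarrow> 'a set) \<Rightarrow>
     (nat \<Rightarrow> ('b \<times> 'b) list) \<Rightarrow> bool" where
  "LGH_realizing_nets T ell A Ts ells As S \<longleftrightarrow>
     (\<exists>Sn. (\<forall>l\<ge>1. nets_converge T ell A Ts ells As (1 / real l) (S l) (Sn l)) \<and>
           extension_property ell ells S Sn) \<and>
     forward_dense T ell A (\<Union>l\<in>{1..}. vertices (S l))"

definition LGH_converges ::
    "'b topology \<Rightarrow> ('b \<Rightarrow> 'b \<Rightarrow> ereal) \<Rightarrow> 'b set \<Rightarrow>
     (nat \<Rightarrow> 'a topology) \<Rightarrow> (nat \<Rightarrow> 'a \<Rightarrow> 'a \<Rightarrow> ereal) \<Rightarrow> (nat \<Rightarrow> 'a set) \<Rightarrow> bool" where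
  "LGH_converges T ell A Ts ells As \<longleftrightarrow> (\<exists>S. LGH_realizing_nets T ell A Ts ells As S)"

lemma LGH_converges_all_scales:
  assumes "LGH_converges T ell A Ts ells As" and "\<epsilon> > 0"
  shows "\<exists>S Sn. nets_converge T ell A Ts ells As \<epsilon> S Sn"
proof -
  obtain S Sn where *: "\<And>l. l \<ge> 1 \<Longrightarrow> nets_converge T ell A Ts ells As (1 / real l) (S l) (Sn l)"
    using assms(1) unfolding LGH_converges_def LGH_realizing_nets_def by blast
  obtain l where "1 / real (Suc l) < \<epsilon>"
    using assms(2) nat_approx_posE by blast
  then have mono: "finite_net T' ell' (1 / real (Suc l)) A' N \<Longrightarrow> finite_net T' ell' \<epsilon> A' N"
    for T' :: "'c topology" and ell' A' N
    unfolding finite_net_def by (auto intro: order_trans)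
  from *[of "Suc l"] have "nets_converge T ell A Ts ells As \<epsilon> (S (Suc l)) (Sn (Suc l))"
    unfolding nets_converge_def
    by (auto simp del: of_nat_Suc intro: mono elim!: eventually_mono)
  then show ?thesis by blast
qed

text \<open>\<open>U k\<close> and \<open>Us n k\<close> are the \<open>k\<close>-th members of the covers of the limit and of the \<open>n\<close>-th space.\<close>
definition pLGH_converges ::
    "'b topology \<Rightarrow> ('b \<Rightarrow> 'b \<Rightarrow> ereal) \<Rightarrow> (nat \<Rightarrow> 'b set) \<Rightarrow>
     (nat \<Rightarrow> 'a topology) \<Rightarrow> (nat \<Rightarrow> 'a \<Rightarrow> 'a \<Rightarrow> ereal) \<Rightarrow> (nat \<Rightarrow> nat \<Rightarrow> 'a set) \<Rightarrow> bool" where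
  "pLGH_converges T ell U Ts ells Us \<longleftrightarrow> (\<forall>k. LGH_converges T ell (U k) Ts ells (\<lambda>n. Us n k))"


section \<open>Limit uniform structures\<close>

definition entourage ::
    "'b topology \<Rightarrow> ('b \<Rightarrow> 'b \<Rightarrow> ereal) \<Rightarrow> 'b \<Rightarrow> real \<Rightarrow> ('b \<times> 'b) set" where
  "entourage T ell s \<delta> =
     {(y, z). y \<in> topspace T \<and> z \<in> topspace T \<and>
        ldiff (ell y s) (ell z s) < ereal \<delta> \<and> ldiff (ell s y) (ell s z) < ereal \<delta>}"

text \<open>
  A uniform structure on a subset \<open>X\<close> of a type is represented by its filter of entourages, which
  contains \<open>X \<times> X\<close>. The sets \<^const>\<open>entourage\<close> form a sub-base of a uniform structure, so the generated
  filter is the generated uniform structure.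
\<close>
definition vertex_uniformity ::
    "'b topology \<Rightarrow> ('b \<Rightarrow> 'b \<Rightarrow> ereal) \<Rightarrow> 'b set \<Rightarrow> ('b \<times> 'b) filter" where
  "vertex_uniformity T ell S =
     inf (principal (topspace T \<times> topspace T))
         (INF (s, \<delta>)\<in>S \<times> {0<..}. principal (entourage T ell s \<delta>))"

definition limit_uniformity ::
    "'b topology \<Rightarrow> ('b \<Rightarrow> 'b \<Rightarrow> ereal) \<Rightarrow> (nat \<Rightarrow> 'b set) \<Rightarrow>
     (nat \<Rightarrow> 'a topology) \<Rightarrow> (nat \<Rightarrow> 'a \<Rightarrow> 'a \<Rightarrow> ereal) \<Rightarrow> (nat \<Rightarrow> nat \<Rightarrow> 'a set) \<Rightarrow>
     ('b \<times> 'b) filter \<Rightarrow> bool" where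
  "limit_uniformity T ell U Ts ells Us \<UU> \<longleftrightarrow>
     (\<exists>N. (\<forall>k. LGH_realizing_nets T ell (U k) Ts ells (\<lambda>n. Us n k) (N k)) \<and>
          \<UU> = vertex_uniformity T ell (\<Union>k. \<Union>l\<in>{1..}. vertices (N k l)))"

definition uniformly_continuous_tau ::
    "('b \<times> 'b) filter \<Rightarrow> ('b \<Rightarrow> 'b \<Rightarrow> ereal) \<Rightarrow> bool" where
  "uniformly_continuous_tau \<UU> ell \<longleftrightarrow>
     (\<forall>\<epsilon>>0. \<forall>\<^sub>F ((x, x'), (y, y')) in \<UU> \<times>\<^sub>F \<UU>. ldiff (tau ell x y) (tau ell x' y') < ereal \<epsilon>)"


section \<open>Completion\<close>

subsection \<open>Hausdorff completion of a uniform space\<close>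

text \<open>
  The points of the completion are the minimal Cauchy filters. The order on \<^typ>\<open>'b filter\<close> is opposite
  to inclusion of the families of sets, so minimal means maximal with respect to \<open>\<le>\<close>.
\<close>
definition cauchy_wrt :: "('b \<times> 'b) filter \<Rightarrow> 'b filter \<Rightarrow> bool" where
  "cauchy_wrt \<UU> F \<longleftrightarrow> F \<noteq> bot \<and> F \<times>\<^sub>F F \<le> \<UU>"

definition ucompletion :: "('b \<times> 'b) filter \<Rightarrow> 'b filter set" where
  "ucompletion \<UU> = {F. cauchy_wrt \<UU> F \<and> (\<forall>G. cauchy_wrt \<UU> G \<and> F \<le> G \<longrightarrow> G = F)}"

definition ucompletion_uniformity :: "('b \<times> 'b) filter \<Rightarrow> ('b filter \<times> 'b filter) filter" where
  "ucompletion_uniformity \<UU> =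
     (INF W\<in>{W. \<forall>\<^sub>F p in \<UU>. p \<in> W}.
        principal {(F, G). F \<in> ucompletion \<UU> \<and> G \<in> ucompletion \<UU> \<and> (\<forall>\<^sub>F p in F \<times>\<^sub>F G. p \<in> W)})"

definition uniform_topology :: "'c set \<Rightarrow> ('c \<times> 'c) filter \<Rightarrow> 'c topology" where
  "uniform_topology C \<VV> =
     topology (\<lambda>Q. Q \<subseteq> C \<and> (\<forall>x\<in>Q. \<forall>\<^sub>F (x', y) in \<VV>. x' = x \<longrightarrow> y \<in> Q))"

lemma openin_uniform_topology:
  "openin (uniform_topology C \<VV>) Q \<longleftrightarrow> Q \<subseteq> C \<and> (\<forall>x\<in>Q. \<forall>\<^sub>F (x', y) in \<VV>. x' = x \<longrightarrow> y \<in> Q)"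
proof -
  have "istopology (\<lambda>Q. Q \<subseteq> C \<and> (\<forall>x\<in>Q. \<forall>\<^sub>F (x', y) in \<VV>. x' = x \<longrightarrow> y \<in> Q))"
    unfolding istopology_def
  proof (intro conjI allI impI ballI; (elim conjE)?)
    fix P Q x
    assume "\<forall>x\<in>P. \<forall>\<^sub>F (x', y) in \<VV>. x' = x \<longrightarrow> y \<in> P"
      "\<forall>x\<in>Q. \<forall>\<^sub>F (x', y) in \<VV>. x' = x \<longrightarrow> y \<in> Q" "x \<in> P \<inter> Q"
    then have "\<forall>\<^sub>F (x', y) in \<VV>. x' = x \<longrightarrow> y \<in> P" "\<forall>\<^sub>F (x', y) in \<VV>. x' = x \<longrightarrow> y \<in> Q"
      by auto
    then show "\<forall>\<^sub>F (x', y) in \<VV>. x' = x \<longrightarrow> y \<in> P \<inter> Q"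
      by eventually_elim auto
  next
    fix \<K> x
    assume *: "\<forall>Q\<in>\<K>. Q \<subseteq> C \<and> (\<forall>x\<in>Q. \<forall>\<^sub>F (x', y) in \<VV>. x' = x \<longrightarrow> y \<in> Q)" and "x \<in> \<Union>\<K>"
    then obtain Q where "Q \<in> \<K>" "\<forall>\<^sub>F (x', y) in \<VV>. x' = x \<longrightarrow> y \<in> Q" by blast
    from this(2) show "\<forall>\<^sub>F (x', y) in \<VV>. x' = x \<longrightarrow> y \<in> \<Union>\<K>"
      by eventually_elim (use \<open>Q \<in> \<K>\<close> in auto)
  qed auto
  then show ?thesis
    by (simp add: uniform_topology_def)
qed

definition ucompletion_topology :: "('b \<times> 'b) filter \<Rightarrow> 'b filter topology" where
  "ucompletion_topology \<UU> = uniform_topology (ucompletion \<UU>) (ucompletion_uniformity \<UU>)"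

text \<open>
  The extension by continuity: the filter \<open>F\<close> on \<open>X\<close> converges to the point \<open>F\<close> of the completion.
\<close>
definition tau_ext :: "('b \<Rightarrow> 'b \<Rightarrow> ereal) \<Rightarrow> 'b filter \<Rightarrow> 'b filter \<Rightarrow> ereal" where
  "tau_ext ell F G = Lim (F \<times>\<^sub>F G) (\<lambda>(x, y). tau ell x y)"

definition le_ext ::
    "('b \<times> 'b) filter \<Rightarrow> ('b \<Rightarrow> 'b \<Rightarrow> ereal) \<Rightarrow> 'b filter \<Rightarrow> 'b filter \<Rightarrow> bool" where
  "le_ext \<UU> ell F G \<longleftrightarrow>
     (\<forall>H\<in>ucompletion \<UU>. tau_ext ell H G \<ge> tau_ext ell H F \<and> tau_ext ell F H \<ge> tau_ext ell G H)"

definition ell_ext ::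
    "('b \<times> 'b) filter \<Rightarrow> ('b \<Rightarrow> 'b \<Rightarrow> ereal) \<Rightarrow> 'b filter \<Rightarrow> 'b filter \<Rightarrow> ereal" where
  "ell_ext \<UU> ell F G = (if le_ext \<UU> ell F G then tau_ext ell F G else -\<infinity>)"


subsection \<open>Identification of points\<close>

definition tau_equiv ::
    "('b \<times> 'b) filter \<Rightarrow> ('b \<Rightarrow> 'b \<Rightarrow> ereal) \<Rightarrow> ('b filter \<times> 'b filter) set" where
  "tau_equiv \<UU> ell =
     {(F, G). F \<in> ucompletion \<UU> \<and> G \<in> ucompletion \<UU> \<and>
        (\<forall>H\<in>ucompletion \<UU>. tau_ext ell F H = tau_ext ell G H \<and> tau_ext ell H F = tau_ext ell H G)}"

lemma equiv_tau_equiv: "equiv (ucompletion \<UU>) (tau_equiv \<UU> ell)"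
  by (rule equivI) (auto simp: tau_equiv_def refl_on_def sym_def trans_def)

definition completion :: "('b \<times> 'b) filter \<Rightarrow> ('b \<Rightarrow> 'b \<Rightarrow> ereal) \<Rightarrow> 'b filter set set" where
  "completion \<UU> ell = ucompletion \<UU> // tau_equiv \<UU> ell"

text \<open>The quotient topology; the preimage of a set \<open>Q\<close> of classes is \<open>\<Union>Q\<close>.\<close>
definition completion_topology ::
    "('b \<times> 'b) filter \<Rightarrow> ('b \<Rightarrow> 'b \<Rightarrow> ereal) \<Rightarrow> 'b filter set topology" where
  "completion_topology \<UU> ell =
     topology (\<lambda>Q. Q \<subseteq> completion \<UU> ell \<and> openin (ucompletion_topology \<UU>) (\<Union>Q))"

lemma openin_completion_topology:
  "openin (completion_topology \<UU> ell) Q \<longleftrightarrow>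
     Q \<subseteq> completion \<UU> ell \<and> openin (ucompletion_topology \<UU>) (\<Union>Q)"
proof -
  have *: "\<Union>(P \<inter> Q) = \<Union>P \<inter> \<Union>Q" if "P \<subseteq> completion \<UU> ell" "Q \<subseteq> completion \<UU> ell" for P Q
  proof
    show "\<Union>P \<inter> \<Union>Q \<subseteq> \<Union>(P \<inter> Q)"
    proof
      fix x assume "x \<in> \<Union>P \<inter> \<Union>Q"
      then obtain C D where "C \<in> P" "D \<in> Q" "x \<in> C" "x \<in> D" by blast
      moreover from this that have "C = D"
        using quotient_disj[OF equiv_tau_equiv, of C \<UU> ell D] unfolding completion_def by blast
      ultimately show "x \<in> \<Union>(P \<inter> Q)" by blast
    qed
  qed auto
  have "istopology (\<lambda>Q. Q \<subseteq> completion \<UU> ell \<and> openin (ucompletion_topology \<UU>) (\<Union>Q))"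
    unfolding istopology_def
  proof (intro conjI allI impI; (elim conjE)?)
    fix \<K>
    assume K: "\<forall>Q\<in>\<K>. Q \<subseteq> completion \<UU> ell \<and> openin (ucompletion_topology \<UU>) (\<Union>Q)"
    have "\<Union>(\<Union>\<K>) = (\<Union>Q\<in>\<K>. \<Union>Q)" by blast
    then show "openin (ucompletion_topology \<UU>) (\<Union>(\<Union>\<K>))"
      using K by auto
  qed (auto simp: * intro: openin_Int)
  then show ?thesis
    by (simp add: completion_topology_def)
qed

text \<open>
  The value of \<open>f\<close> on classes; the image below is a singleton if \<open>f\<close> is compatible with the
  identification, as is the case for \<^const>\<open>tau_ext\<close> and \<^const>\<open>ell_ext\<close>.
\<close>
definition on_classes :: "('c \<Rightarrow> 'c \<Rightarrow> ereal) \<Rightarrow> 'c set \<Rightarrow> 'c set \<Rightarrow> ereal" where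
  "on_classes f C D = the_elem ((\<lambda>(x, y). f x y) ` (C \<times> D))"

definition completion_tau ::
    "('b \<Rightarrow> 'b \<Rightarrow> ereal) \<Rightarrow> 'b filter set \<Rightarrow> 'b filter set \<Rightarrow> ereal" where
  "completion_tau ell = on_classes (tau_ext ell)"

definition completion_ell ::
    "('b \<times> 'b) filter \<Rightarrow> ('b \<Rightarrow> 'b \<Rightarrow> ereal) \<Rightarrow> 'b filter set \<Rightarrow> 'b filter set \<Rightarrow> ereal" where
  "completion_ell \<UU> ell = on_classes (ell_ext \<UU> ell)"

definition timelike_interior ::
    "('b \<times> 'b) filter \<Rightarrow> ('b \<Rightarrow> 'b \<Rightarrow> ereal) \<Rightarrow> 'b filter set set" where
  "timelike_interior \<UU> ell =
     (\<Union>C\<in>completion \<UU> ell. {D \<in> completion \<UU> ell. completion_tau ell C D > 0}) \<inter>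
     (\<Union>C\<in>completion \<UU> ell. {D \<in> completion \<UU> ell. completion_tau ell D C > 0})"

end

theory Submission
  imports Defs
begin

text \<open>
  The extended time separation is real valued, continuous, and inherits from \<open>X\<close> the reverse triangle
  inequality for points at positive distance. The relation \<open>\<le>\<close> on the completion compares all
  distances to and from two points, which makes it a preorder by definition, antisymmetric after the
  identification of points, and closed, being an intersection of closed conditions. It also yields
  the reverse triangle inequality when one of the two distances vanishes, and it contains \<open>\<lless>\<close>, so that
  \<open>\<lless>\<close> is positivity of a continuous function and chronological futures and pasts are open.

  The main point is compactness of causal diamonds. The uniformity is generated by the functions
  \<open>ell s\<close> and \<open>\<lambda>x. ell x s\<close> for vertices \<open>s\<close>, which take values in \<open>{-\<infinity>} \<union> [0, \<infinity>)\<close> with \<open>-\<infinity>\<close> isolated. A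
  set on which each of these functions is bounded above is therefore totally bounded. On the
  diamond between \<open>P\<close> and \<open>Q\<close> they are bounded, since \<open>P \<le> F \<le> Q\<close> means in particular that
  \<open>\<tau>(s, F) \<le> \<tau>(s, Q)\<close> and \<open>\<tau>(F, s) \<le> \<tau>(P, s)\<close>. Being moreover closed in a complete space, the
  diamond is compact. This is done with ultrafilters: an ultrafilter of points of the
  diamond, which are themselves filters on \<open>X\<close>, is flattened to a single filter on \<open>X\<close>
  (\<open>ultra_coordinate\<close> provides the small sets that make it Cauchy), and the corresponding
  point of the completion is a
  limit (\<open>kowalski_sum_limit\<close>).

  Finally, a diamond with endpoints in the timelike interior stays inside it, because a point \<open>E \<lless> P\<close>
  satisfies \<open>\<tau>(E, F) \<ge> \<tau>(E, P) > 0\<close> for all \<open>F \<ge> P\<close>, and dually. Hence passing to the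
  interior does not destroy compactness.
\<close>


section \<open>Ultrafilters and compactness\<close>

definition ultra :: "'c filter \<Rightarrow> bool" where
  "ultra G \<longleftrightarrow> G \<noteq> bot \<and> (\<forall>P. eventually P G \<or> eventually (\<lambda>x. \<not> P x) G)"

lemma ultra_bexD:
  assumes "ultra G" "finite I" "\<forall>\<^sub>F x in G. \<exists>i\<in>I. P i x"
  shows "\<exists>i\<in>I. eventually (P i) G"
proof (rule ccontr)
  assume "\<not> ?thesis"
  then have "\<forall>i\<in>I. \<forall>\<^sub>F x in G. \<not> P i x"
    using assms(1) unfolding ultra_def by blast
  then have "\<forall>\<^sub>F x in G. \<forall>i\<in>I. \<not> P i x"
    using assms(2) by (simp add: eventually_ball_finite_distrib)
  with assms(3) have "\<forall>\<^sub>F x in G. False"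
    by eventually_elim blast
  then show False
    using assms(1) by (simp add: ultra_def eventually_False)
qed

text \<open>
  A minimal proper filter below \<open>F\<close> exists by Zorn's lemma, as the infimum of a chain of proper
  filters is proper; refining it by any predicate gives the filter itself or the improper one.
\<close>
lemma ex_ultra_le:
  fixes F :: "'c filter"
  assumes "F \<noteq> bot"
  shows "\<exists>G\<le>F. ultra G"
proof -
  define A where "A = {G. G \<le> F \<and> G \<noteq> bot}"
  have po: "partial_order_on A (relation_of (\<ge>) A)"
    by (auto simp: partial_order_on_def preorder_on_def refl_on_def relation_of_def trans_def
        antisym_def)
  have "\<exists>m\<in>A. \<forall>a\<in>A. m \<ge> a \<longrightarrow> a = m"
  proof (rule predicate_Zorn[OF po])
    fix C assume C: "C \<in> Chains (relation_of (\<ge>) A)"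
    have "Inf (insert F C) \<noteq> bot"
    proof (rule Inf_filter_not_bot)
      fix Y assume Y: "Y \<subseteq> insert F C" "finite Y"
      have Z: "Z \<subseteq> insert F C \<Longrightarrow> Z \<noteq> {} \<Longrightarrow> Inf Z \<in> Z" if "finite Z" for Z
        using that
      proof (induction Z rule: finite_induct)
        case (insert a Z)
        show ?case
        proof (cases "Z = {}")
          case False
          then have Z: "Inf Z \<in> Z" using insert by auto
          then have "a \<le> Inf Z \<or> Inf Z \<le> a"
            using C insert.prems unfolding Chains_def relation_of_def A_def by blast
          then have "Inf (insert a Z) = a \<or> Inf (insert a Z) = Inf Z"
            by (auto simp: inf_absorb1 inf_absorb2)
          then show ?thesis using Z by auto
        qed auto
      qed auto
      have "insert F C \<subseteq> A"
        using C assms unfolding Chains_def relation_of_def A_def by auto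
      moreover have "(top :: 'c filter) \<noteq> bot" using assms by (metis bot_unique top_greatest)
      ultimately show "Inf Y \<noteq> bot"
        using Z[OF Y(2,1)] Y(1) by (cases "Y = {}") (auto simp: A_def)
    qed
    moreover have "Inf (insert F C) \<le> F" by simp
    ultimately have "Inf (insert F C) \<in> A" by (simp add: A_def)
    moreover have "\<forall>a\<in>C. Inf (insert F C) \<le> a" by (simp add: Inf_lower le_infI2)
    ultimately show "\<exists>u\<in>A. \<forall>a\<in>C. u \<le> a" by blast
  qed
  then obtain G where G: "G \<in> A" and max: "\<And>a. a \<in> A \<Longrightarrow> a \<le> G \<Longrightarrow> a = G" by blast
  have "ultra G"
    unfolding ultra_def
  proof (intro conjI allI)
    show "G \<noteq> bot" using G by (simp add: A_def)
    fix P
    show "eventually P G \<or> (\<forall>\<^sub>F x in G. \<not> P x)"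
    proof (cases "inf G (principal {x. P x}) = bot")
      case True
      then have "\<forall>\<^sub>F x in inf G (principal {x. P x}). False" by simp
      then show ?thesis by (simp add: eventually_inf_principal)
    next
      case False
      then have "inf G (principal {x. P x}) \<in> A"
        using G by (auto simp: A_def intro: le_infI1)
      then have "inf G (principal {x. P x}) = G"
        by (rule max) simp
      then have "G \<le> principal {x. P x}" by (metis inf.cobounded2)
      then show ?thesis by (simp add: le_principal)
    qed
  qed
  with G show ?thesis by (auto simp: A_def)
qed

text \<open>
  If a cover has no finite subcover, the complements of its members in \<open>K\<close> generate a proper filter; an
  ultrafilter below it contains \<open>K\<close> but no member of the cover, hence cannot converge in \<open>K\<close>.
\<close>
lemma compactinI_ultra:
  assumes sub: "K \<subseteq> topspace T"
    and lim: "\<And>G. ultra G \<Longrightarrow> \<forall>\<^sub>F x in G. x \<in> K \<Longrightarrow>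
      \<exists>L\<in>K. \<forall>Q. openin T Q \<longrightarrow> L \<in> Q \<longrightarrow> (\<forall>\<^sub>F x in G. x \<in> Q)"
  shows "compactin T K"
  unfolding compactin_def
proof (intro conjI allI impI sub)
  fix \<C> assume C: "(\<forall>Q\<in>\<C>. openin T Q) \<and> K \<subseteq> \<Union>\<C>"
  show "\<exists>\<D>. finite \<D> \<and> \<D> \<subseteq> \<C> \<and> K \<subseteq> \<Union>\<D>"
  proof (rule ccontr)
    assume nofin: "\<not> ?thesis"
    \<comment> \<open>The empty set is added to the cover to have \<open>K\<close> itself in the filter base.\<close>
    let ?F = "INF Q\<in>insert {} \<C>. principal (K - Q)"
    have "?F \<noteq> bot"
    proof (rule INF_filter_not_bot)
      fix \<D> assume D: "\<D> \<subseteq> insert {} \<C>" "finite \<D>"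
      then have "\<not> K \<subseteq> \<Union>(\<D> - {{}})"
        using nofin by (metis Diff_subset_conv finite_Diff insert_is_Un)
      then have "(\<Inter>Q\<in>\<D>. K - Q) \<noteq> {}" by blast
      then show "(INF Q\<in>\<D>. principal (K - Q)) \<noteq> bot"
        by (simp add: INF_principal_finite D(2) principal_eq_bot_iff)
    qed
    then obtain G where G: "G \<le> ?F" "ultra G" using ex_ultra_le by blast
    have ev: "\<forall>\<^sub>F x in G. x \<in> K - Q" if "Q \<in> insert {} \<C>" for Q
    proof -
      have "G \<le> principal (K - Q)" using order_trans[OF G(1) INF_lower[OF that]] .
      then show ?thesis by (simp only: le_principal)
    qed
    then have "\<forall>\<^sub>F x in G. x \<in> K" by fastforce
    then obtain L where L: "L \<in> K" "\<And>Q. openin T Q \<Longrightarrow> L \<in> Q \<Longrightarrow> \<forall>\<^sub>F x in G. x \<in> Q"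
      using lim[OF G(2)] by blast
    then obtain Q where Q: "Q \<in> \<C>" "L \<in> Q" using C by blast
    then have "\<forall>\<^sub>F x in G. x \<in> Q" using L C by blast
    moreover have "\<forall>\<^sub>F x in G. x \<in> K - Q" using ev Q by blast
    ultimately have "\<forall>\<^sub>F x in G. False" by eventually_elim blast
    then show False using G(2) by (simp add: ultra_def eventually_False)
  qed
qed


section \<open>Completion of a uniform structure\<close>

text \<open>
  A filter of filters is flattened to a filter; the definition is the limit superior of the
  identity along \<open>\<G>\<close>, taken in the lattice of filters.
\<close>
definition kowalski_sum :: "'b filter filter \<Rightarrow> 'b filter" where
  "kowalski_sum \<G> = (INF A\<in>{A. \<forall>\<^sub>F F in \<G>. F \<in> A}. Sup A)"

lemma eventually_kowalski_sum:
  "eventually P (kowalski_sum \<G>) \<longleftrightarrow> (\<forall>\<^sub>F F in \<G>. eventually P F)"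
proof -
  have "eventually P (kowalski_sum \<G>) \<longleftrightarrow> (\<exists>A\<in>{A. \<forall>\<^sub>F F in \<G>. F \<in> A}. eventually P (Sup A))"
    unfolding kowalski_sum_def
  proof (rule eventually_INF_base)
    show "{A. \<forall>\<^sub>F F in \<G>. F \<in> A} \<noteq> {}" by (auto intro: exI[of _ UNIV])
    fix A B assume "A \<in> {A. \<forall>\<^sub>F F in \<G>. F \<in> A}" "B \<in> {A. \<forall>\<^sub>F F in \<G>. F \<in> A}"
    then have "A \<inter> B \<in> {A. \<forall>\<^sub>F F in \<G>. F \<in> A}" by (auto intro: eventually_conj)
    moreover have "Sup (A \<inter> B) \<le> inf (Sup A) (Sup B)" by (auto intro: Sup_subset_mono)
    ultimately show "\<exists>x\<in>{A. \<forall>\<^sub>F F in \<G>. F \<in> A}. Sup x \<le> inf (Sup A) (Sup B)" by blast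
  qed
  also have "\<dots> \<longleftrightarrow> (\<forall>\<^sub>F F in \<G>. eventually P F)"
    by (auto simp: eventually_Sup elim: eventually_mono intro: exI[of _ "{F. eventually P F}"])
  finally show ?thesis .
qed

text \<open>
  For a Cauchy filter \<open>G\<close> this is the point of the completion to which \<open>G\<close> converges; for the
  principal filter of a point of \<open>X\<close> it is the neighbourhood filter, and so the canonical map from \<open>X\<close>
  into its completion.
\<close>
definition round_filter :: "('b \<times> 'b) filter \<Rightarrow> 'b filter \<Rightarrow> 'b filter" where
  "round_filter \<UU> G = (INF W\<in>{W. \<forall>\<^sub>F p in \<UU>. p \<in> W}. principal {y. \<forall>\<^sub>F x in G. (x, y) \<in> W})"

lemma eventually_round_filter:
  "eventually P (round_filter \<UU> G) \<longleftrightarrow>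
     (\<exists>W. (\<forall>\<^sub>F p in \<UU>. p \<in> W) \<and> (\<forall>y. (\<forall>\<^sub>F x in G. (x, y) \<in> W) \<longrightarrow> P y))"
proof -
  have "eventually P (round_filter \<UU> G) \<longleftrightarrow>
     (\<exists>W\<in>{W. \<forall>\<^sub>F p in \<UU>. p \<in> W}. eventually P (principal {y. \<forall>\<^sub>F x in G. (x, y) \<in> W}))"
    unfolding round_filter_def
  proof (rule eventually_INF_base)
    show "{W. \<forall>\<^sub>F p in \<UU>. p \<in> W} \<noteq> {}" by (auto intro: exI[of _ UNIV])
    fix A B assume "A \<in> {W. \<forall>\<^sub>F p in \<UU>. p \<in> W}" "B \<in> {W. \<forall>\<^sub>F p in \<UU>. p \<in> W}"
    then have "A \<inter> B \<in> {W. \<forall>\<^sub>F p in \<UU>. p \<in> W}" by (auto intro: eventually_conj)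
    then show "\<exists>V\<in>{W. \<forall>\<^sub>F p in \<UU>. p \<in> W}. principal {y. \<forall>\<^sub>F x in G. (x, y) \<in> V}
       \<le> inf (principal {y. \<forall>\<^sub>F x in G. (x, y) \<in> A}) (principal {y. \<forall>\<^sub>F x in G. (x, y) \<in> B})"
      by (rule bexI[rotated]) (auto elim: eventually_mono)
  qed
  then show ?thesis by (auto simp: eventually_principal)
qed

lemma openin_ucompletion_topology:
  "openin (ucompletion_topology \<UU>) Q \<longleftrightarrow> Q \<subseteq> ucompletion \<UU> \<and>
     (\<forall>F\<in>Q. \<exists>W. (\<forall>\<^sub>F p in \<UU>. p \<in> W) \<and>
        (\<forall>G\<in>ucompletion \<UU>. (\<forall>\<^sub>F p in F \<times>\<^sub>F G. p \<in> W) \<longrightarrow> G \<in> Q))"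
proof -
  have *: "eventually P (ucompletion_uniformity \<UU>) \<longleftrightarrow> (\<exists>W\<in>{W. \<forall>\<^sub>F p in \<UU>. p \<in> W}. eventually P
     (principal {(F, G). F \<in> ucompletion \<UU> \<and> G \<in> ucompletion \<UU> \<and> (\<forall>\<^sub>F p in F \<times>\<^sub>F G. p \<in> W)}))" for P
    unfolding ucompletion_uniformity_def
  proof (rule eventually_INF_base)
    show "{W. \<forall>\<^sub>F p in \<UU>. p \<in> W} \<noteq> {}" by (auto intro: exI[of _ UNIV])
    fix A B assume "A \<in> {W. \<forall>\<^sub>F p in \<UU>. p \<in> W}" "B \<in> {W. \<forall>\<^sub>F p in \<UU>. p \<in> W}"
    then have "A \<inter> B \<in> {W. \<forall>\<^sub>F p in \<UU>. p \<in> W}" by (auto intro: eventually_conj)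
    then show "\<exists>V\<in>{W. \<forall>\<^sub>F p in \<UU>. p \<in> W}.
        principal {(F, G). F \<in> ucompletion \<UU> \<and> G \<in> ucompletion \<UU> \<and> (\<forall>\<^sub>F p in F \<times>\<^sub>F G. p \<in> V)}
      \<le> inf (principal {(F, G). F \<in> ucompletion \<UU> \<and> G \<in> ucompletion \<UU> \<and> (\<forall>\<^sub>F p in F \<times>\<^sub>F G. p \<in> A)})
         (principal {(F, G). F \<in> ucompletion \<UU> \<and> G \<in> ucompletion \<UU> \<and> (\<forall>\<^sub>F p in F \<times>\<^sub>F G. p \<in> B)})"
      by (rule bexI[rotated]) (auto elim: eventually_mono)
  qed
  have "(\<forall>\<^sub>F (F', G) in ucompletion_uniformity \<UU>. F' = F \<longrightarrow> G \<in> Q) \<longleftrightarrow>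
      (\<exists>W. (\<forall>\<^sub>F p in \<UU>. p \<in> W) \<and>
        (\<forall>G\<in>ucompletion \<UU>. (\<forall>\<^sub>F p in F \<times>\<^sub>F G. p \<in> W) \<longrightarrow> G \<in> Q))"
    if "F \<in> ucompletion \<UU>" for F
    unfolding * eventually_principal using that by auto
  then show ?thesis
    unfolding ucompletion_topology_def openin_uniform_topology by (meson subsetD)
qed

lemma topspace_ucompletion_topology: "topspace (ucompletion_topology \<UU>) = ucompletion \<UU>"
proof -
  have "openin (ucompletion_topology \<UU>) (ucompletion \<UU>)"
    unfolding openin_ucompletion_topology by (auto intro: exI[of _ UNIV])
  then show ?thesis
    by (meson openin_subset openin_topspace openin_ucompletion_topology subset_antisym)
qed

lemma cauchy_wrt_smallD:
  assumes "cauchy_wrt \<UU> F" "eventually P \<UU>"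
  shows "\<exists>A. eventually A F \<and> (\<forall>x y. A x \<longrightarrow> A y \<longrightarrow> P (x, y))"
proof -
  have "eventually P (F \<times>\<^sub>F F)" using assms by (auto simp: cauchy_wrt_def le_filter_def)
  then show ?thesis by (simp add: eventually_prod_same)
qed

lemma round_filter_ge:
  assumes "cauchy_wrt \<UU> G"
  shows "G \<le> round_filter \<UU> G"
  unfolding le_filter_def
proof (intro allI impI)
  fix P assume "eventually P (round_filter \<UU> G)"
  then obtain W where W: "\<forall>\<^sub>F p in \<UU>. p \<in> W" "\<And>y. (\<forall>\<^sub>F x in G. (x, y) \<in> W) \<Longrightarrow> P y"
    unfolding eventually_round_filter by blast
  obtain A where A: "eventually A G" "\<And>x y. A x \<Longrightarrow> A y \<Longrightarrow> (x, y) \<in> W"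
    using cauchy_wrt_smallD[OF assms W(1)] by blast
  show "eventually P G"
    using A(1) by eventually_elim (rule W(2), rule eventually_mono[OF A(1)], rule A(2))
qed

text \<open>
  The second hypothesis combines symmetry and transitivity of a uniformity. The filter
  \<open>round_filter \<UU> G\<close> is the coarsest Cauchy filter above \<open>G\<close>: a \<open>W\<close>-small set of any Cauchy filter
  \<open>H \<ge> G\<close> belongs to \<open>G\<close> too, so all its points are \<open>W\<close>-close to \<open>G\<close>.
\<close>
lemma round_filter_in_ucompletion:
  assumes G: "cauchy_wrt \<UU> G"
    and comp: "\<And>P. eventually P \<UU> \<Longrightarrow>
      \<exists>W. (\<forall>\<^sub>F p in \<UU>. p \<in> W) \<and> (\<forall>x y z. (x, y) \<in> W \<longrightarrow> (x, z) \<in> W \<longrightarrow> P (y, z))"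
  shows "round_filter \<UU> G \<in> ucompletion \<UU>"
proof -
  have ne: "G \<noteq> bot" using G by (simp add: cauchy_wrt_def)
  have "round_filter \<UU> G \<noteq> bot" using round_filter_ge[OF G] ne bot_unique by metis
  moreover have "round_filter \<UU> G \<times>\<^sub>F round_filter \<UU> G \<le> \<UU>"
    unfolding le_filter_def
  proof (intro allI impI)
    fix P assume "eventually P \<UU>"
    then obtain W where W: "\<forall>\<^sub>F p in \<UU>. p \<in> W" "\<And>x y z. (x, y) \<in> W \<Longrightarrow> (x, z) \<in> W \<Longrightarrow> P (y, z)"
      using comp by blast
    have "\<forall>\<^sub>F y in round_filter \<UU> G. \<forall>\<^sub>F x in G. (x, y) \<in> W"
      unfolding eventually_round_filter using W(1) by blast
    moreover have "P (y, z)" if "\<forall>\<^sub>F x in G. (x, y) \<in> W" "\<forall>\<^sub>F x in G. (x, z) \<in> W" for y z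
    proof -
      have "\<forall>\<^sub>F x in G. P (y, z)" using that by eventually_elim (rule W(2))
      then show ?thesis using ne by (simp add: eventually_const)
    qed
    ultimately show "eventually P (round_filter \<UU> G \<times>\<^sub>F round_filter \<UU> G)"
      unfolding eventually_prod_same by blast
  qed
  moreover have "H = round_filter \<UU> G" if H: "cauchy_wrt \<UU> H" "round_filter \<UU> G \<le> H" for H
  proof (rule antisym[OF _ H(2)], unfold le_filter_def, intro allI impI)
    fix P assume "eventually P (round_filter \<UU> G)"
    then obtain W where W: "\<forall>\<^sub>F p in \<UU>. p \<in> W" "\<And>y. (\<forall>\<^sub>F x in G. (x, y) \<in> W) \<Longrightarrow> P y"
      unfolding eventually_round_filter by blast
    obtain A where A: "eventually A H" "\<And>x y. A x \<Longrightarrow> A y \<Longrightarrow> (x, y) \<in> W"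
      using cauchy_wrt_smallD[OF H(1) W(1)] by blast
    have "eventually A G"
      using A(1) H(2) round_filter_ge[OF G] by (auto simp: le_filter_def)
    then show "eventually P H"
      using A by (auto elim!: eventually_mono intro: W(2))
  qed
  ultimately show ?thesis by (auto simp: ucompletion_def cauchy_wrt_def)
qed

lemma ucompletion_cauchy: "F \<in> ucompletion \<UU> \<Longrightarrow> cauchy_wrt \<UU> F"
  by (simp add: ucompletion_def)

text \<open>
  Completeness of the completion, for filters whose flattening is Cauchy: a small set of the limit \<open>L\<close>
  belongs to the flattened filter, hence to \<open>\<G>\<close>-almost all points \<open>F\<close>, which are thus close to \<open>L\<close>.
\<close>
lemma kowalski_sum_limit:
  assumes C: "cauchy_wrt \<UU> (kowalski_sum \<G>)"
    and comp: "\<And>P. eventually P \<UU> \<Longrightarrow>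
      \<exists>W. (\<forall>\<^sub>F p in \<UU>. p \<in> W) \<and> (\<forall>x y z. (x, y) \<in> W \<longrightarrow> (x, z) \<in> W \<longrightarrow> P (y, z))"
    and sub: "\<forall>\<^sub>F F in \<G>. F \<in> ucompletion \<UU>"
    and Q: "openin (ucompletion_topology \<UU>) Q" "round_filter \<UU> (kowalski_sum \<G>) \<in> Q"
  shows "\<forall>\<^sub>F F in \<G>. F \<in> Q"
proof -
  let ?L = "round_filter \<UU> (kowalski_sum \<G>)"
  obtain W where W: "\<forall>\<^sub>F p in \<UU>. p \<in> W"
    "\<And>F. F \<in> ucompletion \<UU> \<Longrightarrow> (\<forall>\<^sub>F p in ?L \<times>\<^sub>F F. p \<in> W) \<Longrightarrow> F \<in> Q"
    using Q unfolding openin_ucompletion_topology by blast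
  have "cauchy_wrt \<UU> ?L"
    using round_filter_in_ucompletion[OF C comp] by (intro ucompletion_cauchy) blast
  then obtain A where A: "eventually A ?L" "\<And>x y. A x \<Longrightarrow> A y \<Longrightarrow> (x, y) \<in> W"
    using cauchy_wrt_smallD[OF _ W(1)] by blast
  have "eventually A (kowalski_sum \<G>)"
    using A(1) round_filter_ge[OF C] by (auto simp: le_filter_def)
  then have "\<forall>\<^sub>F F in \<G>. eventually A F"
    by (simp add: eventually_kowalski_sum)
  then show ?thesis
    using sub
  proof eventually_elim
    case (elim F)
    then show ?case
      using A by (intro W(2)) (auto simp: eventually_prod_filter)
  qed
qed


section \<open>Uniformities generated by the distances to vertices\<close>

lemma ldiff_self [simp]: "ldiff a a = 0"
  by (simp add: ldiff_def)

lemma ldiff_commute: "ldiff a b = ldiff b a"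
  by (cases a; cases b) (auto simp: ldiff_def)

lemma ldiff_triangle: "ldiff a c \<le> ldiff a b + ldiff b c"
  by (cases a; cases b; cases c) (auto simp: ldiff_def)

lemma ldiff_ereal [simp]: "ldiff (ereal x) (ereal y) = ereal \<bar>x - y\<bar>"
  by (auto simp: ldiff_def)

lemma ldiff_less_halves:
  assumes "ldiff b a < ereal (\<delta> / 2)" "ldiff b c < ereal (\<delta> / 2)"
  shows "ldiff a c < ereal \<delta>"
proof -
  have "ldiff a c \<le> ldiff b a + ldiff b c" using ldiff_triangle[of a c b] by (simp add: ldiff_commute)
  also have "\<dots> < ereal (\<delta> / 2) + ereal (\<delta> / 2)" using assms
    by (cases "ldiff b a"; cases "ldiff b c") auto
  finally show ?thesis by simp
qed

text \<open>
  Total boundedness of \<open>{-\<infinity>} \<union> [0, b]\<close> with a Lebesgue number \<open>h\<close>. The overlap of the cells ensures that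
  the values of a coordinate on an \<open>h\<close>-small set fit into one cell, although they need not stay
  below \<open>b\<close> or be nonnegative.
\<close>
lemma finite_cell_cover:
  fixes b \<delta> :: real
  assumes "\<delta> > 0"
  obtains I h where "finite I" "h > 0" "\<And>c u v. c \<in> I \<Longrightarrow> u \<in> c \<Longrightarrow> v \<in> c \<Longrightarrow> ldiff u v < ereal \<delta>"
    "\<And>v. v = -\<infinity> \<or> 0 \<le> v \<Longrightarrow> v \<le> ereal b \<Longrightarrow> \<exists>c\<in>I. \<forall>u. ldiff u v < ereal h \<longrightarrow> u \<in> c"
proof -
  define h where "h = \<delta> / 4"
  have h: "h > 0" "3 * h < \<delta>" using assms by (auto simp: h_def)
  define cell where "cell i = ereal ` {real i * h - h..real i * h + 2 * h}" for i :: nat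
  define I where "I = insert {-\<infinity>} (cell ` {..nat \<lceil>b / h\<rceil>})"
  have "ldiff u v < ereal \<delta>" if "c \<in> I" "u \<in> c" "v \<in> c" for c u v
    using that h by (auto simp: I_def cell_def)
  moreover have "\<exists>c\<in>I. \<forall>u. ldiff u v < ereal h \<longrightarrow> u \<in> c" if v: "v = -\<infinity> \<or> 0 \<le> v" "v \<le> ereal b" for v
  proof (cases "v = -\<infinity>")
    case True
    have "u = -\<infinity>" if "ldiff u v < ereal h" for u
      using that True by (cases u) (auto simp: ldiff_def)
    then show ?thesis by (auto simp: I_def)
  next
    case False
    then obtain r where r: "v = ereal r" "0 \<le> r" "r \<le> b" using v by (cases v) auto
    define i where "i = nat \<lfloor>r / h\<rfloor>"
    have "real i = of_int \<lfloor>r / h\<rfloor>" using r h by (simp add: i_def)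
    then have "real i \<le> r / h" "r / h < real i + 1" by linarith+
    then have i: "real i * h \<le> r" "r < real i * h + h" using h by (auto simp: field_simps)
    have "r / h \<le> b / h" using r h by (simp add: divide_right_mono)
    then have "i \<le> nat \<lceil>b / h\<rceil>" unfolding i_def by linarith
    then have "cell i \<in> I" by (auto simp: I_def)
    moreover have "u \<in> cell i" if u: "ldiff u v < ereal h" for u
    proof -
      obtain q where "u = ereal q" "\<bar>q - r\<bar> < h"
        using u r(1) h(1) by (cases u) (auto simp: ldiff_def split: if_splits)
      then show ?thesis using i unfolding cell_def by (intro image_eqI[of _ _ q]) auto
    qed
    ultimately show ?thesis by blast
  qed
  ultimately show ?thesis using that[of I h] h by (simp add: I_def)
qed

lemma eventually_vertex_uniformity:
  "eventually P (vertex_uniformity T ell S) \<longleftrightarrow>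
     (\<exists>B\<subseteq>S \<times> {0<..}. finite B \<and> (\<forall>x\<in>topspace T. \<forall>y\<in>topspace T.
        (\<forall>(s, \<delta>)\<in>B. (x, y) \<in> entourage T ell s \<delta>) \<longrightarrow> P (x, y)))"
proof -
  have "vertex_uniformity T ell S =
      inf (INF i\<in>S \<times> {0<..}. principal (case i of (s, \<delta>) \<Rightarrow> entourage T ell s \<delta>))
        (principal (topspace T \<times> topspace T))"
    unfolding vertex_uniformity_def case_prod_unfold by (rule inf_commute)
  then have *: "eventually P (vertex_uniformity T ell S) \<longleftrightarrow>
     (\<exists>B\<subseteq>S \<times> {0<..}. finite B \<and> eventually (\<lambda>p. p \<in> topspace T \<times> topspace T \<longrightarrow> P p)
        (INF i\<in>B. principal (case i of (s, \<delta>) \<Rightarrow> entourage T ell s \<delta>)))"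
    by (simp only: eventually_inf_principal) (rule eventually_INF)
  have "eventually (\<lambda>p. p \<in> topspace T \<times> topspace T \<longrightarrow> P p)
        (INF i\<in>B. principal (case i of (s, \<delta>) \<Rightarrow> entourage T ell s \<delta>)) \<longleftrightarrow>
      (\<forall>x\<in>topspace T. \<forall>y\<in>topspace T. (\<forall>(s, \<delta>)\<in>B. (x, y) \<in> entourage T ell s \<delta>) \<longrightarrow> P (x, y))"
    if "finite B" for B
    unfolding INF_principal_finite[OF that] eventually_principal by auto
  then show ?thesis
    unfolding * by (intro ex_cong1 conj_cong refl)
qed

lemma vertex_uniformity_comp:
  assumes "eventually P (vertex_uniformity T ell S)"
  shows "\<exists>W. (\<forall>\<^sub>F p in vertex_uniformity T ell S. p \<in> W) \<and>
           (\<forall>x y z. (x, y) \<in> W \<longrightarrow> (x, z) \<in> W \<longrightarrow> P (y, z))"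
proof -
  obtain B where B: "B \<subseteq> S \<times> {0<..}" "finite B" "\<And>x y. x \<in> topspace T \<Longrightarrow> y \<in> topspace T \<Longrightarrow>
      (\<forall>(s, \<delta>)\<in>B. (x, y) \<in> entourage T ell s \<delta>) \<Longrightarrow> P (x, y)"
    using assms unfolding eventually_vertex_uniformity by blast
  define W where "W = {(x, y). x \<in> topspace T \<and> y \<in> topspace T \<and>
      (\<forall>(s, \<delta>)\<in>B. (x, y) \<in> entourage T ell s (\<delta> / 2))}"
  have "\<forall>\<^sub>F p in vertex_uniformity T ell S. p \<in> W"
    unfolding eventually_vertex_uniformity
  proof (intro exI[of _ "(\<lambda>(s, \<delta>). (s, \<delta> / 2)) ` B"] conjI ballI impI)
    show "(\<lambda>(s, \<delta>). (s, \<delta> / 2)) ` B \<subseteq> S \<times> {0<..}" using B(1) by auto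
    show "finite ((\<lambda>(s, \<delta>). (s, \<delta> / 2)) ` B)" using B(2) by simp
  qed (auto simp: W_def)
  moreover have "P (y, z)" if xyz: "(x, y) \<in> W" "(x, z) \<in> W" for x y z
  proof (rule B(3))
    show "\<forall>(s, \<delta>)\<in>B. (y, z) \<in> entourage T ell s \<delta>"
    proof (intro ballI, clarify)
      fix s \<delta> assume "(s, \<delta>) \<in> B"
      then have "(x, y) \<in> entourage T ell s (\<delta> / 2)" "(x, z) \<in> entourage T ell s (\<delta> / 2)"
        using xyz by (auto simp: W_def)
      then show "(y, z) \<in> entourage T ell s \<delta>"
        by (auto simp: entourage_def intro: ldiff_less_halves)
    qed
  qed (use xyz in \<open>auto simp: W_def\<close>)
  ultimately show ?thesis by blast
qed

lemma eventually_entourage: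
  assumes "s \<in> S" "\<delta> > 0"
  shows "\<forall>\<^sub>F p in vertex_uniformity T ell S. p \<in> entourage T ell s \<delta>"
  unfolding eventually_vertex_uniformity using assms by (intro exI[of _ "{(s, \<delta>)}"]) auto

lemma vertex_uniformity_carrier:
  "\<forall>\<^sub>F p in vertex_uniformity T ell S. p \<in> topspace T \<times> topspace T"
  unfolding eventually_vertex_uniformity by (intro exI[of _ "{}"]) auto

lemma vertex_uniformity_refl:
  assumes "eventually P (vertex_uniformity T ell S)" "x \<in> topspace T"
  shows "P (x, x)"
proof -
  obtain B where "B \<subseteq> S \<times> {0<..}" "\<And>x y. x \<in> topspace T \<Longrightarrow> y \<in> topspace T \<Longrightarrow>
      (\<forall>(s, \<delta>)\<in>B. (x, y) \<in> entourage T ell s \<delta>) \<Longrightarrow> P (x, y)"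
    using assms unfolding eventually_vertex_uniformity by blast
  then show ?thesis using assms(2) by (force simp: entourage_def)
qed

lemma cauchy_principal:
  assumes "x \<in> topspace T"
  shows "cauchy_wrt (vertex_uniformity T ell S) (principal {x})"
  using vertex_uniformity_refl[OF _ assms, of _ ell S]
  by (auto simp: cauchy_wrt_def principal_eq_bot_iff principal_prod_principal le_filter_def
      eventually_principal)

lemma cauchy_eventually_carrier:
  assumes "cauchy_wrt (vertex_uniformity T ell S) F"
  shows "\<forall>\<^sub>F x in F. x \<in> topspace T"
  using cauchy_wrt_smallD[OF assms vertex_uniformity_carrier] by (auto elim!: eventually_mono)


section \<open>The extended time separation\<close>

locale continuous_tau =
  fixes T :: "'b topology" and ell :: "'b \<Rightarrow> 'b \<Rightarrow> ereal" and S :: "'b set"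
  assumes lpls: "lorentzian_pre_length_space T ell"
    and S_sub: "S \<subseteq> topspace T"
    and tau_finite: "\<And>x y. x \<in> topspace T \<Longrightarrow> y \<in> topspace T \<Longrightarrow> tau ell x y < \<infinity>"
    and uc: "uniformly_continuous_tau (vertex_uniformity T ell S) ell"
begin

abbreviation "\<UU> \<equiv> vertex_uniformity T ell S"
abbreviation "Xc \<equiv> ucompletion \<UU>"

definition rtau :: "'b \<Rightarrow> 'b \<Rightarrow> real" where
  "rtau x y = real_of_ereal (tau ell x y)"

definition rtau_ext :: "'b filter \<Rightarrow> 'b filter \<Rightarrow> real" where
  "rtau_ext F G = real_of_ereal (tau_ext ell F G)"

lemma tau_eq_rtau: "x \<in> topspace T \<Longrightarrow> y \<in> topspace T \<Longrightarrow> tau ell x y = ereal (rtau x y)"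
  using tau_finite[of x y] by (cases "tau ell x y") (auto simp: rtau_def tau_def max_def split: if_splits)

lemma rtau_nonneg: "rtau x y \<ge> 0"
  by (simp add: rtau_def tau_def real_of_ereal_pos)

lemma ell_eq_rtau: "x \<in> topspace T \<Longrightarrow> y \<in> topspace T \<Longrightarrow> rtau x y > 0 \<Longrightarrow> ell x y = ereal (rtau x y)"
  using tau_eq_rtau[of x y] by (auto simp: tau_def max_def zero_ereal_def split: if_splits)

lemma ell_le_rtau: "x \<in> topspace T \<Longrightarrow> y \<in> topspace T \<Longrightarrow> ell x y \<le> ereal (rtau x y)"
  using tau_eq_rtau[of x y] by (metis max.cobounded2 tau_def)

lemma rtau_triangle:
  assumes "x \<in> topspace T" "y \<in> topspace T" "z \<in> topspace T" "rtau x y > 0" "rtau y z > 0"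
  shows "rtau x y + rtau y z \<le> rtau x z"
proof -
  have "lsum (ell x y) (ell y z) \<le> ell x z"
    using lpls assms(1-3) by (auto simp: lorentzian_pre_length_space_def)
  also have "\<dots> \<le> ereal (rtau x z)" using assms by (intro ell_le_rtau)
  finally show ?thesis using assms by (simp add: ell_eq_rtau lsum_def)
qed

lemma rtau_uniform:
  assumes "e > 0"
  shows "\<exists>W. (\<forall>\<^sub>F p in \<UU>. p \<in> W) \<and>
    (\<forall>x x' y y'. (x, x') \<in> W \<longrightarrow> (y, y') \<in> W \<longrightarrow> \<bar>rtau x y - rtau x' y'\<bar> < e)"
proof -
  obtain P Q where PQ: "eventually P \<UU>" "eventually Q \<UU>"
    "\<And>x x' y y'. P (x, x') \<Longrightarrow> Q (y, y') \<Longrightarrow> ldiff (tau ell x y) (tau ell x' y') < ereal e"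
    using uc assms unfolding uniformly_continuous_tau_def eventually_prod_filter by fastforce
  \<comment> \<open>Only on the carrier is \<open>tau\<close> known to be finite, hence equal to \<open>rtau\<close>.\<close>
  define W where "W = {p. P p \<and> Q p \<and> p \<in> topspace T \<times> topspace T}"
  have "\<forall>\<^sub>F p in \<UU>. p \<in> W"
    using PQ(1,2) vertex_uniformity_carrier[of T ell S] by eventually_elim (auto simp: W_def)
  moreover have "\<bar>rtau x y - rtau x' y'\<bar> < e" if "(x, x') \<in> W" "(y, y') \<in> W" for x x' y y'
    using that PQ(3)[of x x' y y'] by (auto simp: W_def tau_eq_rtau)
  ultimately show ?thesis by blast
qed

lemma Xc_cauchy: "F \<in> Xc \<Longrightarrow> cauchy_wrt \<UU> F"
  by (rule ucompletion_cauchy)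

lemma Xc_nontrivial: "F \<in> Xc \<Longrightarrow> F \<noteq> bot"
  by (simp add: ucompletion_def cauchy_wrt_def)

lemma Xc_carrier: "F \<in> Xc \<Longrightarrow> \<forall>\<^sub>F x in F. x \<in> topspace T"
  by (rule cauchy_eventually_carrier[OF Xc_cauchy])

lemma Xc_witness:
  assumes "F \<in> Xc" "eventually P F" "eventually Q F"
  obtains x where "P x" "Q x" "x \<in> topspace T"
proof -
  have "\<forall>\<^sub>F x in F. P x \<and> Q x \<and> x \<in> topspace T"
    using assms(2,3) Xc_carrier[OF assms(1)] by eventually_elim auto
  then show ?thesis using that Xc_nontrivial[OF assms(1)] eventually_happens' by blast
qed

text \<open>
  The image of \<open>F \<times>\<^sub>F G\<close> under \<open>rtau\<close> is a Cauchy filter on the reals, so the limit that defines the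
  extension exists and is finite.
\<close>
lemma tau_ext_converges:
  assumes F: "F \<in> Xc" and G: "G \<in> Xc"
  shows "((\<lambda>(x, y). rtau x y) \<longlongrightarrow> rtau_ext F G) (F \<times>\<^sub>F G)" "tau_ext ell F G = ereal (rtau_ext F G)"
proof -
  have ne: "F \<times>\<^sub>F G \<noteq> bot"
    using F G by (simp add: Xc_nontrivial prod_filter_eq_bot)
  have "cauchy_filter (filtermap (\<lambda>(x, y). rtau x y) (F \<times>\<^sub>F G))"
    unfolding cauchy_filter_metric_filtermap
  proof (intro allI impI)
    fix e :: real assume "e > 0"
    then obtain W where W: "\<forall>\<^sub>F p in \<UU>. p \<in> W"
      "\<And>x x' y y'. (x, x') \<in> W \<Longrightarrow> (y, y') \<in> W \<Longrightarrow> \<bar>rtau x y - rtau x' y'\<bar> < e"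
      using rtau_uniform by blast
    obtain A where A: "eventually A F" "\<And>x y. A x \<Longrightarrow> A y \<Longrightarrow> (x, y) \<in> W"
      using cauchy_wrt_smallD[OF Xc_cauchy[OF F] W(1)] by blast
    obtain B where B: "eventually B G" "\<And>x y. B x \<Longrightarrow> B y \<Longrightarrow> (x, y) \<in> W"
      using cauchy_wrt_smallD[OF Xc_cauchy[OF G] W(1)] by blast
    have "\<forall>\<^sub>F p in F \<times>\<^sub>F G. A (fst p) \<and> B (snd p)"
      using A(1) B(1) by (auto simp: eventually_prod_filter)
    then show "\<exists>P. eventually P (F \<times>\<^sub>F G) \<and> (\<forall>p q. P p \<and> P q \<longrightarrow>
        dist (case p of (x, y) \<Rightarrow> rtau x y) (case q of (x, y) \<Rightarrow> rtau x y) < e)"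
      using A(2) B(2) W(2) by (intro exI[of _ "\<lambda>p. A (fst p) \<and> B (snd p)"]) (auto simp: dist_real_def)
  qed
  moreover have "filtermap (\<lambda>(x, y). rtau x y) (F \<times>\<^sub>F G) \<noteq> bot"
    using ne by (simp add: filtermap_bot_iff)
  ultimately obtain r where "filtermap (\<lambda>(x, y). rtau x y) (F \<times>\<^sub>F G) \<le> nhds r"
    using cauchy_filter_complete_converges[OF _ complete_UNIV] by auto
  then have r: "((\<lambda>(x, y). rtau x y) \<longlongrightarrow> r) (F \<times>\<^sub>F G)"
    by (simp add: filterlim_def)
  then have "((\<lambda>p. ereal (case p of (x, y) \<Rightarrow> rtau x y)) \<longlongrightarrow> ereal r) (F \<times>\<^sub>F G)"
    by (rule tendsto_ereal)
  moreover have "\<forall>\<^sub>F p in F \<times>\<^sub>F G. fst p \<in> topspace T \<and> snd p \<in> topspace T"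
    unfolding eventually_prod_filter using Xc_carrier[OF F] Xc_carrier[OF G]
    by (intro exI[of _ "\<lambda>x. x \<in> topspace T"]) auto
  then have "\<forall>\<^sub>F p in F \<times>\<^sub>F G. ereal (case p of (x, y) \<Rightarrow> rtau x y) = (case p of (x, y) \<Rightarrow> tau ell x y)"
    by eventually_elim (auto simp: tau_eq_rtau)
  ultimately have "((\<lambda>(x, y). tau ell x y) \<longlongrightarrow> ereal r) (F \<times>\<^sub>F G)"
    by (rule Lim_transform_eventually)
  then have "tau_ext ell F G = ereal r"
    using ne unfolding tau_ext_def by (intro tendsto_Lim)
  then show "((\<lambda>(x, y). rtau x y) \<longlongrightarrow> rtau_ext F G) (F \<times>\<^sub>F G)" "tau_ext ell F G = ereal (rtau_ext F G)"
    using r by (auto simp: rtau_ext_def)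
qed

lemma rtau_ext_near:
  assumes "F \<in> Xc" "G \<in> Xc" "e > 0"
  obtains A B where "eventually A F" "eventually B G" "\<And>x y. A x \<Longrightarrow> B y \<Longrightarrow> \<bar>rtau x y - rtau_ext F G\<bar> < e"
proof -
  have "\<forall>\<^sub>F p in F \<times>\<^sub>F G. dist (case p of (x, y) \<Rightarrow> rtau x y) (rtau_ext F G) < e"
    using tau_ext_converges(1)[OF assms(1,2)] assms(3) by (rule tendstoD)
  then show ?thesis using that by (auto simp: eventually_prod_filter dist_real_def)
qed

lemma rtau_ext_nonneg:
  assumes "F \<in> Xc" "G \<in> Xc"
  shows "rtau_ext F G \<ge> 0"
proof (rule field_le_epsilon)
  fix e :: real assume "e > 0"
  then obtain A B where AB: "eventually A F" "eventually B G"
      "\<And>x y. A x \<Longrightarrow> B y \<Longrightarrow> \<bar>rtau x y - rtau_ext F G\<bar> < e"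
    using rtau_ext_near[OF assms] by blast
  obtain x y where "A x" "B y" using Xc_witness[OF assms(1) AB(1,1)] Xc_witness[OF assms(2) AB(2,2)] by metis
  then have "\<bar>rtau x y - rtau_ext F G\<bar> < e" by (rule AB(3))
  then show "0 \<le> rtau_ext F G + e" using rtau_nonneg[of x y] by linarith
qed

text \<open>
  Positivity is an open condition, so nearby points of \<open>X\<close> are chronologically related and
  satisfy the inequality.
\<close>
lemma rtau_ext_triangle:
  assumes FGH: "F \<in> Xc" "G \<in> Xc" "H \<in> Xc" and pos: "rtau_ext F G > 0" "rtau_ext G H > 0"
  shows "rtau_ext F G + rtau_ext G H \<le> rtau_ext F H"
proof (rule field_le_epsilon)
  fix e0 :: real assume "e0 > 0"
  define e where "e = Min {e0 / 3, rtau_ext F G, rtau_ext G H}"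
  have e: "e > 0" "3 * e \<le> e0" "e \<le> rtau_ext F G" "e \<le> rtau_ext G H"
    using \<open>e0 > 0\<close> pos by (auto simp: e_def min_def)
  obtain A B where 1: "eventually A F" "eventually B G"
      "\<And>x y. A x \<Longrightarrow> B y \<Longrightarrow> \<bar>rtau x y - rtau_ext F G\<bar> < e"
    using rtau_ext_near[OF FGH(1,2) e(1)] by blast
  obtain B' C where 2: "eventually B' G" "eventually C H"
      "\<And>x y. B' x \<Longrightarrow> C y \<Longrightarrow> \<bar>rtau x y - rtau_ext G H\<bar> < e"
    using rtau_ext_near[OF FGH(2,3) e(1)] by blast
  obtain A' C' where 3: "eventually A' F" "eventually C' H"
      "\<And>x y. A' x \<Longrightarrow> C' y \<Longrightarrow> \<bar>rtau x y - rtau_ext F H\<bar> < e"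
    using rtau_ext_near[OF FGH(1,3) e(1)] by blast
  obtain x where x: "A x" "A' x" "x \<in> topspace T" using Xc_witness[OF FGH(1) 1(1) 3(1)] .
  obtain y where y: "B y" "B' y" "y \<in> topspace T" using Xc_witness[OF FGH(2) 1(2) 2(1)] .
  obtain z where z: "C z" "C' z" "z \<in> topspace T" using Xc_witness[OF FGH(3) 2(2) 3(2)] .
  have *: "\<bar>rtau x y - rtau_ext F G\<bar> < e" "\<bar>rtau y z - rtau_ext G H\<bar> < e" "\<bar>rtau x z - rtau_ext F H\<bar> < e"
    using 1(3) 2(3) 3(3) x y z by blast+
  then have "rtau x y > 0" "rtau y z > 0" using e by linarith+
  then have "rtau x y + rtau y z \<le> rtau x z" using x y z by (intro rtau_triangle)
  then show "rtau_ext F G + rtau_ext G H \<le> rtau_ext F H + e0" using * e by linarith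
qed

lemma rtau_ext_continuous:
  assumes "e > 0"
  shows "\<exists>W. (\<forall>\<^sub>F p in \<UU>. p \<in> W) \<and> (\<forall>F\<in>Xc. \<forall>F'\<in>Xc. \<forall>G\<in>Xc. (\<forall>\<^sub>F p in F \<times>\<^sub>F F'. p \<in> W) \<longrightarrow>
    \<bar>rtau_ext F G - rtau_ext F' G\<bar> < e \<and> \<bar>rtau_ext G F - rtau_ext G F'\<bar> < e)"
proof -
  have e3: "e / 3 > 0" using assms by simp
  then obtain W where W: "\<forall>\<^sub>F p in \<UU>. p \<in> W"
    "\<And>x x' y y'. (x, x') \<in> W \<Longrightarrow> (y, y') \<in> W \<Longrightarrow> \<bar>rtau x y - rtau x' y'\<bar> < e / 3"
    using rtau_uniform by blast
  have Wr: "(x, x) \<in> W" if "x \<in> topspace T" for x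
    using vertex_uniformity_refl[OF W(1) that] .
  have "\<bar>rtau_ext F G - rtau_ext F' G\<bar> < e \<and> \<bar>rtau_ext G F - rtau_ext G F'\<bar> < e"
    if FG: "F \<in> Xc" "F' \<in> Xc" "G \<in> Xc" and ev: "\<forall>\<^sub>F p in F \<times>\<^sub>F F'. p \<in> W" for F F' G
  proof
    obtain P P' where P: "eventually P F" "eventually P' F'" "\<And>x y. P x \<Longrightarrow> P' y \<Longrightarrow> (x, y) \<in> W"
      using ev by (auto simp: eventually_prod_filter)
    obtain A B where 1: "eventually A F" "eventually B G"
        "\<And>x y. A x \<Longrightarrow> B y \<Longrightarrow> \<bar>rtau x y - rtau_ext F G\<bar> < e / 3"
      using rtau_ext_near[OF FG(1,3) e3] by blast
    obtain A' B' where 2: "eventually A' F'" "eventually B' G"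
        "\<And>x y. A' x \<Longrightarrow> B' y \<Longrightarrow> \<bar>rtau x y - rtau_ext F' G\<bar> < e / 3"
      using rtau_ext_near[OF FG(2,3) e3] by blast
    obtain x where x: "P x" "A x" using Xc_witness[OF FG(1) P(1) 1(1)] .
    obtain x' where x': "P' x'" "A' x'" using Xc_witness[OF FG(2) P(2) 2(1)] .
    obtain y where y: "B y" "B' y" "y \<in> topspace T" using Xc_witness[OF FG(3) 1(2) 2(2)] .
    have "\<bar>rtau x y - rtau x' y\<bar> < e / 3" using W(2) P(3) x x' y Wr by blast
    then show "\<bar>rtau_ext F G - rtau_ext F' G\<bar> < e"
      using 1(3)[OF x(2) y(1)] 2(3)[OF x'(2) y(2)] by linarith
    obtain A B where 1: "eventually A G" "eventually B F"
        "\<And>x y. A x \<Longrightarrow> B y \<Longrightarrow> \<bar>rtau x y - rtau_ext G F\<bar> < e / 3"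
      using rtau_ext_near[OF FG(3,1) e3] by blast
    obtain A' B' where 2: "eventually A' G" "eventually B' F'"
        "\<And>x y. A' x \<Longrightarrow> B' y \<Longrightarrow> \<bar>rtau x y - rtau_ext G F'\<bar> < e / 3"
      using rtau_ext_near[OF FG(3,2) e3] by blast
    obtain x where x: "P x" "B x" using Xc_witness[OF FG(1) P(1) 1(2)] .
    obtain x' where x': "P' x'" "B' x'" using Xc_witness[OF FG(2) P(2) 2(2)] .
    obtain y where y: "A y" "A' y" "y \<in> topspace T" using Xc_witness[OF FG(3) 1(1) 2(1)] .
    have "\<bar>rtau y x - rtau y x'\<bar> < e / 3" using W(2) P(3) x x' y Wr by blast
    then show "\<bar>rtau_ext G F - rtau_ext G F'\<bar> < e"
      using 1(3)[OF y(1) x(2)] 2(3)[OF y(2) x'(2)] by linarith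
  qed
  then show ?thesis using W(1) by blast
qed

lemma openin_rtau_ext:
  assumes E: "E \<in> Xc" and "open O'"
  shows "openin (ucompletion_topology \<UU>) {F \<in> Xc. rtau_ext E F \<in> O'}" (is ?A)
    and "openin (ucompletion_topology \<UU>) {F \<in> Xc. rtau_ext F E \<in> O'}" (is ?B)
proof -
  have *: "\<exists>W. (\<forall>\<^sub>F p in \<UU>. p \<in> W) \<and> (\<forall>G\<in>Xc. (\<forall>\<^sub>F p in F \<times>\<^sub>F G. p \<in> W) \<longrightarrow> f G \<in> O')"
    if F: "F \<in> Xc" "f F \<in> O'" and f: "f = rtau_ext E \<or> f = (\<lambda>F. rtau_ext F E)" for F f
  proof -
    obtain e where e: "e > 0" "\<And>r. \<bar>f F - r\<bar> < e \<Longrightarrow> r \<in> O'"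
      using \<open>open O'\<close> F(2) unfolding open_dist by (metis abs_minus_commute dist_real_def)
    obtain W where W: "\<forall>\<^sub>F p in \<UU>. p \<in> W" "\<forall>F\<in>Xc. \<forall>F'\<in>Xc. \<forall>G\<in>Xc. (\<forall>\<^sub>F p in F \<times>\<^sub>F F'. p \<in> W) \<longrightarrow>
      \<bar>rtau_ext F G - rtau_ext F' G\<bar> < e \<and> \<bar>rtau_ext G F - rtau_ext G F'\<bar> < e"
      using rtau_ext_continuous[OF e(1)] by blast
    then show ?thesis using F(1) E f e(2) by blast
  qed
  show ?A ?B unfolding openin_ucompletion_topology
    using *[of _ "rtau_ext E"] *[of _ "\<lambda>F. rtau_ext F E"] by auto
qed


section \<open>Compactness of causal diamonds\<close>

text \<open>
  Each Cauchy filter \<open>F\<close> contains a set that \<open>f\<close> maps into one of finitely many small cells. An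
  ultrafilter selects one cell for almost all \<open>F\<close>, and the preimage of this cell belongs to the
  flattened filter.
\<close>
lemma ultra_coordinate:
  assumes G: "ultra \<G>" and bdd: "\<forall>\<^sub>F F in \<G>. F \<in> Xc \<and> (\<forall>\<^sub>F x in F. f x \<le> ereal b)"
    and f: "f = ell s \<or> f = (\<lambda>x. ell x s)" and s: "s \<in> S" and \<delta>: "\<delta> > 0"
  shows "\<exists>A. eventually A (kowalski_sum \<G>) \<and> (\<forall>x y. A x \<longrightarrow> A y \<longrightarrow> ldiff (f x) (f y) < ereal \<delta>)"
proof -
  obtain I h where I: "finite I" and h: "h > 0"
    and small: "\<And>c u v. c \<in> I \<Longrightarrow> u \<in> c \<Longrightarrow> v \<in> c \<Longrightarrow> ldiff u v < ereal \<delta>"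
    and cell: "\<And>v. v = -\<infinity> \<or> 0 \<le> v \<Longrightarrow> v \<le> ereal b \<Longrightarrow> \<exists>c\<in>I. \<forall>u. ldiff u v < ereal h \<longrightarrow> u \<in> c"
    using finite_cell_cover[OF \<delta>, of b] by metis
  have "\<forall>\<^sub>F F in \<G>. \<exists>c\<in>I. \<forall>\<^sub>F x in F. f x \<in> c"
    using bdd
  proof eventually_elim
    case (elim F)
    then have F: "F \<in> Xc" "\<forall>\<^sub>F x in F. f x \<le> ereal b" by auto
    obtain A where A: "eventually A F" "\<And>x y. A x \<Longrightarrow> A y \<Longrightarrow> (x, y) \<in> entourage T ell s h"
      using cauchy_wrt_smallD[OF Xc_cauchy[OF F(1)] eventually_entourage[OF s h]] by blast
    obtain x where x: "A x" "f x \<le> ereal b" "x \<in> topspace T" using Xc_witness[OF F(1) A(1) F(2)] .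
    have "\<forall>x\<in>topspace T. \<forall>y\<in>topspace T. ell x y = -\<infinity> \<or> ell x y \<ge> 0"
      using lpls by (simp add: lorentzian_pre_length_space_def)
    moreover have "s \<in> topspace T" using s S_sub by auto
    ultimately have "f x = -\<infinity> \<or> 0 \<le> f x" using f x(3) by auto
    then obtain c where c: "c \<in> I" "\<And>u. ldiff u (f x) < ereal h \<Longrightarrow> u \<in> c"
      using cell x(2) by metis
    have "ldiff (f y) (f x) < ereal h" if "A y" for y
      using A(2)[OF that x(1)] f by (auto simp: entourage_def)
    then have "\<forall>\<^sub>F y in F. f y \<in> c"
      using A(1) c(2) by (auto elim!: eventually_mono)
    then show ?case using c(1) by blast
  qed
  then obtain c where c: "c \<in> I" "\<forall>\<^sub>F F in \<G>. \<forall>\<^sub>F x in F. f x \<in> c"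
    using ultra_bexD[OF G I, of "\<lambda>c F. \<forall>\<^sub>F x in F. f x \<in> c"] by blast
  show ?thesis
    using c small by (intro exI[of _ "\<lambda>x. f x \<in> c"]) (auto simp: eventually_kowalski_sum)
qed

lemma ex_vertex_filter:
  assumes "s \<in> S"
  obtains E where "E \<in> Xc" "\<And>A. eventually A E \<Longrightarrow> A s"
proof -
  have C: "cauchy_wrt \<UU> (principal {s})" using assms S_sub by (intro cauchy_principal) auto
  then have "round_filter \<UU> (principal {s}) \<in> Xc"
    by (rule round_filter_in_ucompletion[OF _ vertex_uniformity_comp])
  moreover have "A s" if "eventually A (round_filter \<UU> (principal {s}))" for A
    using that round_filter_ge[OF C] by (auto simp: le_filter_def eventually_principal)
  ultimately show ?thesis using that by blast
qed

lemma le_ext_iff: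
  assumes "F \<in> Xc" "G \<in> Xc"
  shows "le_ext \<UU> ell F G \<longleftrightarrow>
    (\<forall>H\<in>Xc. rtau_ext H F \<le> rtau_ext H G \<and> rtau_ext G H \<le> rtau_ext F H)"
  using assms by (auto simp: le_ext_def tau_ext_converges(2))

lemma not_le_ext_iff:
  assumes "F \<in> Xc" "G \<in> Xc"
  shows "\<not> le_ext \<UU> ell F G \<longleftrightarrow>
    (\<exists>H\<in>Xc. rtau_ext H G < rtau_ext H F \<or> rtau_ext F H < rtau_ext G H)"
  unfolding le_ext_iff[OF assms] not_le[symmetric] by blast

text \<open>
  In the two lemmas below, the bound at the vertex \<open>s\<close> is the distance between the image of \<open>s\<close> in
  the completion and the endpoint of the diamond; the summand \<open>1\<close> absorbs the passage from \<open>F\<close> to the points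
  of \<open>X\<close> that approximate it.
\<close>
lemma past_bounded:
  assumes "s \<in> S" "Q \<in> Xc"
  obtains b where "\<And>F. F \<in> Xc \<Longrightarrow> le_ext \<UU> ell F Q \<Longrightarrow> \<forall>\<^sub>F x in F. ell s x \<le> ereal b"
proof -
  obtain E where E: "E \<in> Xc" "\<And>A. eventually A E \<Longrightarrow> A s"
    using ex_vertex_filter[OF assms(1)] by metis
  have "\<forall>\<^sub>F x in F. ell s x \<le> ereal (rtau_ext E Q + 1)" if F: "F \<in> Xc" "le_ext \<UU> ell F Q" for F
  proof -
    obtain A B where AB: "eventually A E" "eventually B F"
        "\<And>x y. A x \<Longrightarrow> B y \<Longrightarrow> \<bar>rtau x y - rtau_ext E F\<bar> < 1"
      using rtau_ext_near[OF E(1) F(1) zero_less_one] by blast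
    have le: "rtau_ext E F \<le> rtau_ext E Q" using F E assms by (auto simp: le_ext_iff)
    show ?thesis
      using AB(2) Xc_carrier[OF F(1)]
    proof eventually_elim
      case (elim x)
      have "ell s x \<le> ereal (rtau s x)" using elim assms S_sub by (intro ell_le_rtau) auto
      also have "rtau s x \<le> rtau_ext E Q + 1" using AB(3)[OF E(2)[OF AB(1)] elim(1)] le by linarith
      finally show ?case by simp
    qed
  qed
  then show ?thesis using that by blast
qed

lemma future_bounded:
  assumes "s \<in> S" "P \<in> Xc"
  obtains b where "\<And>F. F \<in> Xc \<Longrightarrow> le_ext \<UU> ell P F \<Longrightarrow> \<forall>\<^sub>F x in F. ell x s \<le> ereal b"
proof -
  obtain E where E: "E \<in> Xc" "\<And>A. eventually A E \<Longrightarrow> A s"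
    using ex_vertex_filter[OF assms(1)] by metis
  have "\<forall>\<^sub>F x in F. ell x s \<le> ereal (rtau_ext P E + 1)" if F: "F \<in> Xc" "le_ext \<UU> ell P F" for F
  proof -
    obtain A B where AB: "eventually A F" "eventually B E"
        "\<And>x y. A x \<Longrightarrow> B y \<Longrightarrow> \<bar>rtau x y - rtau_ext F E\<bar> < 1"
      using rtau_ext_near[OF F(1) E(1) zero_less_one] by blast
    have le: "rtau_ext F E \<le> rtau_ext P E" using F E assms by (auto simp: le_ext_iff)
    show ?thesis
      using AB(1) Xc_carrier[OF F(1)]
    proof eventually_elim
      case (elim x)
      have "ell x s \<le> ereal (rtau x s)" using elim assms S_sub by (intro ell_le_rtau) auto
      also have "rtau x s \<le> rtau_ext P E + 1" using AB(3)[OF elim(1) E(2)[OF AB(2)]] le by linarith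
      finally show ?case by simp
    qed
  qed
  then show ?thesis using that by blast
qed

lemma openin_not_le_ext:
  assumes "P \<in> Xc"
  shows "openin (ucompletion_topology \<UU>) {F \<in> Xc. \<not> le_ext \<UU> ell P F}" (is ?A)
    and "openin (ucompletion_topology \<UU>) {F \<in> Xc. \<not> le_ext \<UU> ell F P}" (is ?B)
proof -
  have "{F \<in> Xc. \<not> le_ext \<UU> ell P F} =
    {F \<in> Xc. (\<exists>H\<in>Xc. rtau_ext H F < rtau_ext H P \<or> rtau_ext P H < rtau_ext F H)}"
    using assms by (simp add: not_le_ext_iff cong: conj_cong)
  also have "\<dots> = (\<Union>H\<in>Xc. {F \<in> Xc. rtau_ext H F \<in> {..<rtau_ext H P}}) \<union>
      (\<Union>H\<in>Xc. {F \<in> Xc. rtau_ext F H \<in> {rtau_ext P H<..}})"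
    by auto
  finally show ?A
    by (simp only:) (intro openin_Un openin_Union; clarify;
        intro openin_rtau_ext open_lessThan open_greaterThan; assumption)
  have "{F \<in> Xc. \<not> le_ext \<UU> ell F P} =
    {F \<in> Xc. (\<exists>H\<in>Xc. rtau_ext H P < rtau_ext H F \<or> rtau_ext F H < rtau_ext P H)}"
    using assms by (simp add: not_le_ext_iff cong: conj_cong)
  also have "\<dots> = (\<Union>H\<in>Xc. {F \<in> Xc. rtau_ext H F \<in> {rtau_ext H P<..}}) \<union>
      (\<Union>H\<in>Xc. {F \<in> Xc. rtau_ext F H \<in> {..<rtau_ext P H}})"
    by auto
  finally show ?B
    by (simp only:) (intro openin_Un openin_Union; clarify;
        intro openin_rtau_ext open_lessThan open_greaterThan; assumption)
qed

text \<open>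
  The flattened filter is Cauchy by boundedness of the coordinates, and its limit lies in the
  diamond because the complement of the diamond is a union of two open sets.
\<close>
lemma compactin_diamond:
  assumes P: "P \<in> Xc" and Q: "Q \<in> Xc"
  shows "compactin (ucompletion_topology \<UU>) {F \<in> Xc. le_ext \<UU> ell P F \<and> le_ext \<UU> ell F Q}"
    (is "compactin _ ?K")
proof (rule compactinI_ultra)
  show "?K \<subseteq> topspace (ucompletion_topology \<UU>)" by (auto simp: topspace_ucompletion_topology)
  fix \<G> :: "'b filter filter" assume G: "ultra \<G>" and K: "\<forall>\<^sub>F F in \<G>. F \<in> ?K"
  let ?H = "kowalski_sum \<G>"
  have sub: "\<forall>\<^sub>F F in \<G>. F \<in> Xc" using K by eventually_elim auto
  have ne: "\<G> \<noteq> bot" using G by (simp add: ultra_def)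
  have "?H \<noteq> bot"
  proof
    assume "?H = bot"
    then have "\<forall>\<^sub>F F in \<G>. F = bot"
      using eventually_kowalski_sum[of "\<lambda>_. False" \<G>] by (simp add: eventually_False)
    then have "\<forall>\<^sub>F F in \<G>. False"
      using sub by eventually_elim (simp add: Xc_nontrivial)
    then show False using ne by (simp add: eventually_False)
  qed
  moreover have "?H \<times>\<^sub>F ?H \<le> \<UU>"
    unfolding vertex_uniformity_def
  proof (intro le_infI INF_greatest)
    have "\<forall>\<^sub>F x in ?H. x \<in> topspace T"
      unfolding eventually_kowalski_sum using sub by eventually_elim (rule Xc_carrier)
    then show "?H \<times>\<^sub>F ?H \<le> principal (topspace T \<times> topspace T)"
      unfolding le_principal eventually_prod_same by auto
    fix i :: "'b \<times> real" assume "i \<in> S \<times> {0<..}"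
    then obtain s \<delta> where i: "i = (s, \<delta>)" "s \<in> S" "\<delta> > 0" by auto
    obtain b where b: "\<And>F. F \<in> Xc \<Longrightarrow> le_ext \<UU> ell F Q \<Longrightarrow> \<forall>\<^sub>F x in F. ell s x \<le> ereal b"
      using past_bounded[OF i(2) Q] by blast
    have "\<forall>\<^sub>F F in \<G>. F \<in> Xc \<and> (\<forall>\<^sub>F x in F. ell s x \<le> ereal b)"
      using K by eventually_elim (use b in blast)
    then obtain A where A: "eventually A ?H" "\<And>x y. A x \<Longrightarrow> A y \<Longrightarrow> ldiff (ell s x) (ell s y) < ereal \<delta>"
      using ultra_coordinate[OF G _ _ i(2,3), of "ell s"] by blast
    obtain b' where b': "\<And>F. F \<in> Xc \<Longrightarrow> le_ext \<UU> ell P F \<Longrightarrow> \<forall>\<^sub>F x in F. ell x s \<le> ereal b'"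
      using future_bounded[OF i(2) P] by blast
    have "\<forall>\<^sub>F F in \<G>. F \<in> Xc \<and> (\<forall>\<^sub>F x in F. ell x s \<le> ereal b')"
      using K by eventually_elim (use b' in blast)
    then obtain A' where A': "eventually A' ?H" "\<And>x y. A' x \<Longrightarrow> A' y \<Longrightarrow> ldiff (ell x s) (ell y s) < ereal \<delta>"
      using ultra_coordinate[OF G _ _ i(2,3), of "\<lambda>x. ell x s"] by blast
    have "\<forall>\<^sub>F x in ?H. A x \<and> A' x \<and> x \<in> topspace T"
      using A(1) A'(1) \<open>\<forall>\<^sub>F x in ?H. x \<in> topspace T\<close> by eventually_elim auto
    then show "?H \<times>\<^sub>F ?H \<le> (case i of (s, \<delta>) \<Rightarrow> principal (entourage T ell s \<delta>))"
      unfolding i prod.case le_principal eventually_prod_same entourage_def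
      using A(2) A'(2) by (intro exI[of _ "\<lambda>x. A x \<and> A' x \<and> x \<in> topspace T"]) auto
  qed
  ultimately have C: "cauchy_wrt \<UU> ?H" by (simp add: cauchy_wrt_def)
  let ?L = "round_filter \<UU> ?H"
  have lim: "\<forall>\<^sub>F F in \<G>. F \<in> O'" if "openin (ucompletion_topology \<UU>) O'" "?L \<in> O'" for O'
    by (rule kowalski_sum_limit[OF C vertex_uniformity_comp sub that])
  have LX: "?L \<in> Xc" by (rule round_filter_in_ucompletion[OF C vertex_uniformity_comp])
  have "?L \<in> ?K"
  proof (rule ccontr)
    assume "?L \<notin> ?K"
    then have "\<forall>\<^sub>F F in \<G>. F \<notin> ?K"
      using lim[OF openin_not_le_ext(1)[OF P]] lim[OF openin_not_le_ext(2)[OF Q]] LX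
      by (auto elim: eventually_mono)
    then have "\<forall>\<^sub>F F in \<G>. False" using K by eventually_elim blast
    then show False using ne by (simp add: eventually_False)
  qed
  then show "\<exists>L\<in>?K. \<forall>O'. openin (ucompletion_topology \<UU>) O' \<longrightarrow> L \<in> O' \<longrightarrow> (\<forall>\<^sub>F F in \<G>. F \<in> O')"
    using lim by blast
qed


section \<open>Passage to classes\<close>

abbreviation "cls F \<equiv> tau_equiv \<UU> ell `` {F}"
abbreviation "CT \<equiv> completion_topology \<UU> ell"

lemma tau_equiv_iff:
  "(F, G) \<in> tau_equiv \<UU> ell \<longleftrightarrow> F \<in> Xc \<and> G \<in> Xc \<and>
     (\<forall>H\<in>Xc. rtau_ext F H = rtau_ext G H \<and> rtau_ext H F = rtau_ext H G)"
  by (auto simp: tau_equiv_def tau_ext_converges(2))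

lemma completion_eq: "completion \<UU> ell = cls ` Xc"
  by (auto simp: completion_def quotient_def)

lemma in_cls: "F \<in> Xc \<Longrightarrow> F \<in> cls F"
  by (simp add: tau_equiv_iff)

lemma cls_eqI: "(F, G) \<in> tau_equiv \<UU> ell \<Longrightarrow> cls F = cls G"
  by (rule equiv_class_eq[OF equiv_tau_equiv])

lemma on_classes_cls:
  assumes "F \<in> Xc" "G \<in> Xc"
    and "\<And>F' G'. (F, F') \<in> tau_equiv \<UU> ell \<Longrightarrow> (G, G') \<in> tau_equiv \<UU> ell \<Longrightarrow> f F' G' = f F G"
  shows "on_classes f (cls F) (cls G) = f F G"
proof -
  have "(\<lambda>(x, y). f x y) ` (cls F \<times> cls G) = (\<lambda>_. f F G) ` (cls F \<times> cls G)"
    using assms(3) by (intro image_cong) auto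
  moreover have "cls F \<times> cls G \<noteq> {}" using in_cls assms(1,2) by blast
  ultimately show ?thesis by (simp add: on_classes_def image_constant_conv)
qed

lemma completion_tau_cls:
  assumes "F \<in> Xc" "G \<in> Xc"
  shows "completion_tau ell (cls F) (cls G) = ereal (rtau_ext F G)"
  unfolding completion_tau_def using assms
  by (subst on_classes_cls) (auto simp: tau_equiv_iff tau_ext_converges(2))

lemma completion_ell_cls:
  assumes "F \<in> Xc" "G \<in> Xc"
  shows "completion_ell \<UU> ell (cls F) (cls G) =
    (if le_ext \<UU> ell F G then ereal (rtau_ext F G) else -\<infinity>)"
proof -
  have "ell_ext \<UU> ell F' G' = ell_ext \<UU> ell F G"
    if "(F, F') \<in> tau_equiv \<UU> ell" "(G, G') \<in> tau_equiv \<UU> ell" for F' G'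
    using that by (auto simp: tau_equiv_iff ell_ext_def tau_ext_converges(2) le_ext_iff)
  then have "completion_ell \<UU> ell (cls F) (cls G) = ell_ext \<UU> ell F G"
    unfolding completion_ell_def using assms by (intro on_classes_cls)
  then show ?thesis using assms by (simp add: ell_ext_def tau_ext_converges(2))
qed

text \<open>
  If \<open>rtau_ext H F = 0\<close>, the first inequality is trivial, and otherwise it follows from the reverse
  triangle inequality; the second one is dual.
\<close>
lemma rtau_ext_pos_imp_le_ext:
  assumes "F \<in> Xc" "G \<in> Xc" "rtau_ext F G > 0"
  shows "le_ext \<UU> ell F G"
  unfolding le_ext_iff[OF assms(1,2)]
proof (intro ballI conjI)
  fix H assume H: "H \<in> Xc"
  show "rtau_ext H F \<le> rtau_ext H G"
    using rtau_ext_triangle[OF H assms(1,2) _ assms(3)] assms(3) rtau_ext_nonneg[OF H assms(1)]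
      rtau_ext_nonneg[OF H assms(2)] by fastforce
  show "rtau_ext G H \<le> rtau_ext F H"
    using rtau_ext_triangle[OF assms(1,2) H assms(3)] assms(3) rtau_ext_nonneg[OF assms(1) H]
      rtau_ext_nonneg[OF assms(2) H] by fastforce
qed

lemma completion_ell_pos_iff:
  assumes "F \<in> Xc" "G \<in> Xc"
  shows "completion_ell \<UU> ell (cls F) (cls G) > 0 \<longleftrightarrow> rtau_ext F G > 0"
  using assms rtau_ext_pos_imp_le_ext[OF assms] by (auto simp: completion_ell_cls)

lemma completion_ell_nonneg_iff:
  assumes "F \<in> Xc" "G \<in> Xc"
  shows "completion_ell \<UU> ell (cls F) (cls G) \<ge> 0 \<longleftrightarrow> le_ext \<UU> ell F G"
  using assms rtau_ext_nonneg[OF assms] by (simp add: completion_ell_cls)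

lemma openin_cls_image:
  assumes "openin (ucompletion_topology \<UU>) Q"
    and "\<And>F G. F \<in> Q \<Longrightarrow> (F, G) \<in> tau_equiv \<UU> ell \<Longrightarrow> G \<in> Q"
  shows "openin CT (cls ` Q)"
proof -
  have Q: "Q \<subseteq> Xc" using assms(1) by (simp add: openin_ucompletion_topology)
  then have "\<Union> (cls ` Q) = Q" using assms(2) in_cls by blast
  then show ?thesis
    using assms(1) Q by (auto simp: openin_completion_topology completion_eq)
qed

lemma topspace_completion: "topspace CT = completion \<UU> ell"
proof -
  have "openin CT (cls ` Xc)"
    by (rule openin_cls_image) (use openin_topspace[of "ucompletion_topology \<UU>"] in
        \<open>auto simp: topspace_ucompletion_topology tau_equiv_iff\<close>)
  then show ?thesis
    by (metis completion_eq openin_completion_topology openin_subset openin_topspace subset_antisym)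
qed

lemma openin_cls_rtau_ext:
  assumes "E \<in> Xc" "open O'"
  shows "openin CT (cls ` {F \<in> Xc. rtau_ext E F \<in> O'})" "openin CT (cls ` {F \<in> Xc. rtau_ext F E \<in> O'})"
  using assms by (auto intro!: openin_cls_image openin_rtau_ext simp: tau_equiv_iff)

lemma continuous_map_cls: "continuous_map (ucompletion_topology \<UU>) CT cls"
  unfolding continuous_map_def
proof (intro conjI allI impI)
  show "cls \<in> topspace (ucompletion_topology \<UU>) \<rightarrow> topspace CT"
    by (auto simp: topspace_completion completion_eq topspace_ucompletion_topology)
  fix Q assume Q: "openin CT Q"
  then have QQ: "Q \<subseteq> cls ` Xc" "openin (ucompletion_topology \<UU>) (\<Union>Q)"
    by (auto simp: openin_completion_topology completion_eq)
  have "cls F \<in> Q \<longleftrightarrow> F \<in> \<Union>Q" if F: "F \<in> Xc" for F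
  proof
    assume "F \<in> \<Union>Q"
    then obtain G where "G \<in> Xc" "F \<in> cls G" "cls G \<in> Q" using QQ(1) by blast
    then show "cls F \<in> Q" using cls_eqI[of G F] by simp
  qed (use in_cls[OF F] in blast)
  moreover have "\<Union>Q \<subseteq> Xc" using QQ(2) by (simp add: openin_ucompletion_topology)
  ultimately have "{F \<in> topspace (ucompletion_topology \<UU>). cls F \<in> Q} = \<Union>Q"
    by (auto simp: topspace_ucompletion_topology)
  then show "openin (ucompletion_topology \<UU>) {F \<in> topspace (ucompletion_topology \<UU>). cls F \<in> Q}"
    using QQ(2) by simp
qed

definition interior_filters :: "'b filter set" where
  "interior_filters = {F \<in> Xc. (\<exists>E\<in>Xc. rtau_ext E F > 0) \<and> (\<exists>E\<in>Xc. rtau_ext F E > 0)}"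

lemma interior_filters_Xc: "F \<in> interior_filters \<Longrightarrow> F \<in> Xc"
  by (simp add: interior_filters_def)

lemma timelike_interior_eq: "timelike_interior \<UU> ell = cls ` interior_filters"
proof -
  have "timelike_interior \<UU> ell = cls ` {F \<in> Xc.
      (\<exists>E\<in>Xc. completion_tau ell (cls E) (cls F) > 0) \<and> (\<exists>E\<in>Xc. completion_tau ell (cls F) (cls E) > 0)}"
    unfolding timelike_interior_def completion_eq by blast
  then show ?thesis
    by (simp add: completion_tau_cls interior_filters_def cong: conj_cong)
qed

abbreviation "IT \<equiv> subtopology CT (timelike_interior \<UU> ell)"

lemma topspace_IT: "topspace IT = cls ` interior_filters"
  by (auto simp: topspace_completion completion_eq timelike_interior_eq interior_filters_Xc)

lemma interior_cls_cases:
  assumes "C \<in> topspace IT"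
  obtains F where "C = cls F" "F \<in> Xc" "F \<in> interior_filters"
  using assms unfolding topspace_IT using interior_filters_Xc by blast

text \<open>
  Continuity in each argument separately is all that openness of chronological futures and closedness of
  \<open>\<le>\<close> require. Joint continuity on classes would be harder: a product of quotient maps need not be a
  quotient map.
\<close>
lemma openin_IT_rtau_ext:
  assumes "E \<in> Xc" "open O'"
  shows "openin IT (cls ` interior_filters \<inter> cls ` {F \<in> Xc. rtau_ext E F \<in> O'})"
    "openin IT (cls ` interior_filters \<inter> cls ` {F \<in> Xc. rtau_ext F E \<in> O'})"
  using openin_cls_rtau_ext[OF assms]
  by (auto simp: timelike_interior_eq intro: openin_subtopology_Int2)

lemma le_ext_refl: "le_ext \<UU> ell F F"
  by (simp add: le_ext_def)

lemma le_ext_trans: "le_ext \<UU> ell F G \<Longrightarrow> le_ext \<UU> ell G H \<Longrightarrow> le_ext \<UU> ell F H"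
  by (meson le_ext_def order_trans)

text \<open>
  When one of the distances vanishes, the inequality is the monotonicity of distances built into \<open>\<le>\<close>.
\<close>
lemma rtau_ext_triangle_le:
  assumes "F \<in> Xc" "G \<in> Xc" "H \<in> Xc" "le_ext \<UU> ell F G" "le_ext \<UU> ell G H"
  shows "rtau_ext F G + rtau_ext G H \<le> rtau_ext F H"
proof (cases "rtau_ext F G > 0 \<and> rtau_ext G H > 0")
  case True
  then show ?thesis using rtau_ext_triangle assms by blast
next
  case False
  then have "rtau_ext F G = 0 \<or> rtau_ext G H = 0"
    using rtau_ext_nonneg assms by (metis less_eq_real_def)
  moreover have "rtau_ext G H \<le> rtau_ext F H" "rtau_ext F G \<le> rtau_ext F H"
    using assms by (auto simp: le_ext_iff)
  ultimately show ?thesis by auto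
qed

lemma lorentzian_pre_length_space_IT: "lorentzian_pre_length_space IT (completion_ell \<UU> ell)"
  unfolding lorentzian_pre_length_space_def
proof (intro conjI ballI)
  fix C assume "C \<in> topspace IT"
  then obtain F where F: "C = cls F" "F \<in> Xc" by (rule interior_cls_cases)
  show "completion_ell \<UU> ell C C \<ge> 0"
    using F by (simp add: completion_ell_nonneg_iff le_ext_refl)
  have "timelike_future IT (completion_ell \<UU> ell) C =
      cls ` interior_filters \<inter> cls ` {G \<in> Xc. rtau_ext F G \<in> {0<..}}"
    unfolding timelike_future_def topspace_IT using F
    by (auto simp: completion_ell_pos_iff interior_filters_Xc)
  then show "openin IT (timelike_future IT (completion_ell \<UU> ell) C)"
    using openin_IT_rtau_ext(1)[OF F(2) open_greaterThan] by (simp only:)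
  have "timelike_past IT (completion_ell \<UU> ell) C =
      cls ` interior_filters \<inter> cls ` {G \<in> Xc. rtau_ext G F \<in> {0<..}}"
    unfolding timelike_past_def topspace_IT using F
    by (auto simp: completion_ell_pos_iff interior_filters_Xc)
  then show "openin IT (timelike_past IT (completion_ell \<UU> ell) C)"
    using openin_IT_rtau_ext(2)[OF F(2) open_greaterThan] by (simp only:)
  fix D assume "D \<in> topspace IT"
  then obtain G where G: "D = cls G" "G \<in> Xc" by (rule interior_cls_cases)
  show "completion_ell \<UU> ell C D = -\<infinity> \<or> completion_ell \<UU> ell C D \<ge> 0"
    using F G rtau_ext_nonneg by (simp add: completion_ell_cls)
  fix E assume "E \<in> topspace IT"
  then obtain H where H: "E = cls H" "H \<in> Xc" by (rule interior_cls_cases)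
  show "lsum (completion_ell \<UU> ell C D) (completion_ell \<UU> ell D E) \<le> completion_ell \<UU> ell C E"
    using F G H rtau_ext_triangle_le[of F G H] le_ext_trans[of F G H]
    by (auto simp: completion_ell_cls lsum_def)
qed

lemma partial_order_IT: "partial_order_on (topspace IT) (causal_rel IT (completion_ell \<UU> ell))"
proof -
  have iff: "(cls F, cls G) \<in> causal_rel IT (completion_ell \<UU> ell) \<longleftrightarrow> le_ext \<UU> ell F G"
    if "F \<in> interior_filters" "G \<in> interior_filters" for F G
    using that by (auto simp: causal_rel_def topspace_IT completion_ell_nonneg_iff
        interior_filters_Xc simp del: topspace_subtopology)
  have sub: "causal_rel IT (completion_ell \<UU> ell) \<subseteq> topspace IT \<times> topspace IT"
    by (auto simp: causal_rel_def)
  have "refl_on (topspace IT) (causal_rel IT (completion_ell \<UU> ell))"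
    unfolding refl_on_def topspace_IT using iff le_ext_refl by blast
  moreover have "trans (causal_rel IT (completion_ell \<UU> ell))"
  proof (rule transI)
    fix C D E assume CDE: "(C, D) \<in> causal_rel IT (completion_ell \<UU> ell)"
      "(D, E) \<in> causal_rel IT (completion_ell \<UU> ell)"
    then have "C \<in> topspace IT" "D \<in> topspace IT" "E \<in> topspace IT" using sub by auto
    then obtain F G H where FGH: "C = cls F" "F \<in> interior_filters" "D = cls G" "G \<in> interior_filters"
        "E = cls H" "H \<in> interior_filters" by (meson interior_cls_cases)
    then show "(C, E) \<in> causal_rel IT (completion_ell \<UU> ell)"
      using CDE iff le_ext_trans by blast
  qed
  moreover have "antisym (causal_rel IT (completion_ell \<UU> ell))"
  proof (rule antisymI)
    fix C D assume CD: "(C, D) \<in> causal_rel IT (completion_ell \<UU> ell)"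
      "(D, C) \<in> causal_rel IT (completion_ell \<UU> ell)"
    then have "C \<in> topspace IT" "D \<in> topspace IT" using sub by auto
    then obtain F G where FG: "C = cls F" "F \<in> interior_filters" "D = cls G" "G \<in> interior_filters"
      by (meson interior_cls_cases)
    then have "le_ext \<UU> ell F G" "le_ext \<UU> ell G F" using CD iff by blast+
    then have "(F, G) \<in> tau_equiv \<UU> ell"
      using FG interior_filters_Xc by (auto simp: tau_equiv_iff le_ext_iff intro: antisym)
    then show "C = D" using FG cls_eqI by simp
  qed
  ultimately show ?thesis
    using sub by (simp add: partial_order_on_def preorder_on_def)
qed

lemma not_causal_box:
  assumes "V \<subseteq> topspace IT" "W \<subseteq> topspace IT"
    and "\<And>C D. C \<in> V \<Longrightarrow> D \<in> W \<Longrightarrow> \<not> completion_ell \<UU> ell C D \<ge> 0"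
  shows "V \<times> W \<subseteq> topspace (prod_topology IT IT) - causal_rel IT (completion_ell \<UU> ell)"
  unfolding topspace_prod_topology causal_rel_def using assms by blast

text \<open>
  A failure of \<open>\<le>\<close> is witnessed by one point \<open>H\<close> and a real number strictly between two distances; the
  same \<open>H\<close> and number witness it on a product neighbourhood.
\<close>
lemma closedin_causal_IT:
  "closedin (prod_topology IT IT) (causal_rel IT (completion_ell \<UU> ell))"
proof -
  let ?R = "causal_rel IT (completion_ell \<UU> ell)"
  have sub: "?R \<subseteq> topspace (prod_topology IT IT)"
    by (auto simp: causal_rel_def)
  have "openin (prod_topology IT IT) (topspace (prod_topology IT IT) - ?R)"
    unfolding openin_prod_topology_alt
  proof (intro allI impI)
    fix C D assume "(C, D) \<in> topspace (prod_topology IT IT) - ?R"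
    then have CD: "C \<in> topspace IT" "D \<in> topspace IT" "\<not> completion_ell \<UU> ell C D \<ge> 0"
      by (auto simp: causal_rel_def)
    obtain F where F: "C = cls F" "F \<in> Xc" "F \<in> interior_filters" using CD(1) by (rule interior_cls_cases)
    obtain G where G: "D = cls G" "G \<in> Xc" "G \<in> interior_filters" using CD(2) by (rule interior_cls_cases)
    have "\<not> le_ext \<UU> ell F G" using CD(3) F G by (simp add: completion_ell_nonneg_iff)
    then obtain H where H: "H \<in> Xc" "rtau_ext H G < rtau_ext H F \<or> rtau_ext F H < rtau_ext G H"
      using F G by (auto simp: not_le_ext_iff)
    from H(2) show "\<exists>V W. openin IT V \<and> openin IT W \<and> C \<in> V \<and> D \<in> W \<and>
        V \<times> W \<subseteq> topspace (prod_topology IT IT) - ?R"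
    proof
      assume "rtau_ext H G < rtau_ext H F"
      then obtain a where a: "rtau_ext H G < a" "a < rtau_ext H F" using dense by blast
      let ?V = "cls ` interior_filters \<inter> cls ` {F \<in> Xc. rtau_ext H F \<in> {a<..}}"
      let ?W = "cls ` interior_filters \<inter> cls ` {F \<in> Xc. rtau_ext H F \<in> {..<a}}"
      have "\<not> completion_ell \<UU> ell V W \<ge> 0" if VW: "V \<in> ?V" "W \<in> ?W" for V W
      proof -
        obtain F' where F': "V = cls F'" "F' \<in> Xc" "rtau_ext H F' > a" using VW by auto
        obtain G' where G': "W = cls G'" "G' \<in> Xc" "rtau_ext H G' < a" using VW by auto
        have "\<not> le_ext \<UU> ell F' G'" using F' G' H(1) by (force simp: le_ext_iff)
        then show ?thesis using F' G' by (simp add: completion_ell_nonneg_iff)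
      qed
      then have "?V \<times> ?W \<subseteq> topspace (prod_topology IT IT) - ?R"
        by (intro not_causal_box) (auto simp only: topspace_IT)
      moreover have "openin IT ?V" "openin IT ?W" 
        by (simp_all only: H(1) openin_IT_rtau_ext open_greaterThan open_lessThan)
      moreover have "C \<in> ?V" "D \<in> ?W" using F G a by auto
      ultimately show ?thesis by blast
    next
      assume "rtau_ext F H < rtau_ext G H"
      then obtain a where a: "rtau_ext F H < a" "a < rtau_ext G H" using dense by blast
      let ?V = "cls ` interior_filters \<inter> cls ` {F \<in> Xc. rtau_ext F H \<in> {..<a}}"
      let ?W = "cls ` interior_filters \<inter> cls ` {F \<in> Xc. rtau_ext F H \<in> {a<..}}"
      have "\<not> completion_ell \<UU> ell V W \<ge> 0" if VW: "V \<in> ?V" "W \<in> ?W" for V W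
      proof -
        obtain F' where F': "V = cls F'" "F' \<in> Xc" "rtau_ext F' H < a" using VW by auto
        obtain G' where G': "W = cls G'" "G' \<in> Xc" "rtau_ext G' H > a" using VW by auto
        have "\<not> le_ext \<UU> ell F' G'" using F' G' H(1) by (force simp: le_ext_iff)
        then show ?thesis using F' G' by (simp add: completion_ell_nonneg_iff)
      qed
      then have "?V \<times> ?W \<subseteq> topspace (prod_topology IT IT) - ?R"
        by (intro not_causal_box) (auto simp only: topspace_IT)
      moreover have "openin IT ?V" "openin IT ?W" 
        by (simp_all only: H(1) openin_IT_rtau_ext open_greaterThan open_lessThan)
      moreover have "C \<in> ?V" "D \<in> ?W" using F G a by auto
      ultimately show ?thesis by blast
    qed
  qed
  then show ?thesis using sub by (simp add: closedin_def)
qed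

lemma interior_filters_convex:
  assumes "P \<in> interior_filters" "Q \<in> interior_filters" "F \<in> Xc" "le_ext \<UU> ell P F" "le_ext \<UU> ell F Q"
  shows "F \<in> interior_filters"
proof -
  obtain E E' where E: "E \<in> Xc" "rtau_ext E P > 0" "E' \<in> Xc" "rtau_ext Q E' > 0"
    using assms(1,2) by (auto simp: interior_filters_def)
  have "rtau_ext E P \<le> rtau_ext E F" "rtau_ext Q E' \<le> rtau_ext F E'"
    using assms E by (auto simp: le_ext_iff interior_filters_Xc)
  then show ?thesis using E assms(3) by (force simp: interior_filters_def)
qed

lemma compactin_diamond_IT:
  assumes "C \<in> topspace IT" "D \<in> topspace IT"
  shows "compactin IT (causal_diamond IT (completion_ell \<UU> ell) C D)"
proof -
  obtain P where P: "C = cls P" "P \<in> Xc" "P \<in> interior_filters" using assms(1) by (rule interior_cls_cases)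
  obtain Q where Q: "D = cls Q" "Q \<in> Xc" "Q \<in> interior_filters" using assms(2) by (rule interior_cls_cases)
  have "causal_diamond IT (completion_ell \<UU> ell) C D =
      cls ` {F \<in> interior_filters. le_ext \<UU> ell P F \<and> le_ext \<UU> ell F Q}"
    unfolding causal_diamond_def topspace_IT using P Q
    by (auto simp: completion_ell_nonneg_iff interior_filters_Xc)
  also have "\<dots> = cls ` {F \<in> Xc. le_ext \<UU> ell P F \<and> le_ext \<UU> ell F Q}"
    using interior_filters_convex[OF P(3) Q(3)] interior_filters_Xc by (intro arg_cong[of _ _ "image cls"]) auto
  finally have eq: "causal_diamond IT (completion_ell \<UU> ell) C D = \<dots>" .
  have "compactin CT (causal_diamond IT (completion_ell \<UU> ell) C D)"
    unfolding eq by (rule image_compactin[OF compactin_diamond[OF P(2) Q(2)] continuous_map_cls])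
  then show ?thesis
    by (auto simp: compactin_subtopology causal_diamond_def)
qed

end

theorem theoremA15:
  fixes Ts :: "nat \<Rightarrow> 'a topology" and ells :: "nat \<Rightarrow> 'a \<Rightarrow> 'a \<Rightarrow> ereal"
    and ps :: "nat \<Rightarrow> 'a" and Us :: "nat \<Rightarrow> nat \<Rightarrow> 'a set"
    and T :: "'b topology" and ell :: "'b \<Rightarrow> 'b \<Rightarrow> ereal"
    and p :: "'b" and U :: "nat \<Rightarrow> 'b set"
    and \<UU> :: "('b \<times> 'b) filter"
  assumes "\<And>n. covered_lorentzian_pre_length_space (Ts n) (ells n) (ps n) (Us n)"
    and "covered_lorentzian_pre_length_space T ell p U"
    and "pLGH_converges T ell U Ts ells Us"
    and "limit_uniformity T ell U Ts ells Us \<UU>"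
    and "uniformly_continuous_tau \<UU> ell"
    and "\<And>n. globally_hyperbolic (Ts n) (ells n)"
  shows "globally_hyperbolic
           (subtopology (completion_topology \<UU> ell) (timelike_interior \<UU> ell))
           (completion_ell \<UU> ell)"
proof -
  obtain N where N: "\<And>k. LGH_realizing_nets T ell (U k) Ts ells (\<lambda>n. Us n k) (N k)"
    and UU: "\<UU> = vertex_uniformity T ell (\<Union>k. \<Union>l\<in>{1..}. vertices (N k l))"
    using assms(4) unfolding limit_uniformity_def by blast
  have cov: "lorentzian_pre_length_space T ell" "(\<Union>k. U k) = topspace T" "\<And>k. U k \<subseteq> U (Suc k)"
    "\<And>k. (SUP (x, y)\<in>U k \<times> U k. tau ell x y) < \<infinity>"
    using assms(2) unfolding covered_lorentzian_pre_length_space_def by auto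
  interpret continuous_tau T ell "\<Union>k. \<Union>l\<in>{1..}. vertices (N k l)"
  proof
    show "lorentzian_pre_length_space T ell" by (rule cov)
    show "(\<Union>k. \<Union>l\<in>{1..}. vertices (N k l)) \<subseteq> topspace T"
    proof (intro UN_least)
      fix k l :: nat assume "l \<in> {1..}"
      then have "finite_net T ell (1 / real l) (U k) (N k l)"
        using N[of k] unfolding LGH_realizing_nets_def nets_converge_def by auto
      then show "vertices (N k l) \<subseteq> topspace T"
        by (auto simp: finite_net_def vertices_def)
    qed
    show "tau ell x y < \<infinity>" if xy: "x \<in> topspace T" "y \<in> topspace T" for x y
    proof -
      obtain i j where ij: "x \<in> U i" "y \<in> U j" using xy cov(2) by blast
      have "U i \<subseteq> U (max i j)" "U j \<subseteq> U (max i j)"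
        using lift_Suc_mono_le[of U] cov(3) by auto
      then have "(x, y) \<in> U (max i j) \<times> U (max i j)" using ij by auto
      then have "(case (x, y) of (x, y) \<Rightarrow> tau ell x y) \<le> (SUP (x, y)\<in>U (max i j) \<times> U (max i j). tau ell x y)"
        by (rule SUP_upper)
      then show ?thesis using cov(4)[of "max i j"] by auto
    qed
    show "uniformly_continuous_tau (vertex_uniformity T ell (\<Union>k. \<Union>l\<in>{1..}. vertices (N k l))) ell"
      using assms(5) UU by simp
  qed
  show ?thesis
    unfolding globally_hyperbolic_def UU
    using lorentzian_pre_length_space_IT partial_order_IT closedin_causal_IT compactin_diamond_IT
    by blast
qed

end
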